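(* Fix positive coset-depending weights $w_i:S_{-i}\to(0,\infty)$, $i=1,\dots,n$, $n\ge2$, and let $G$ be a finite game with $n$ players and $|S_i|=k_i$. With $B_{cw}=[B_{cw}^{P^0},B^N,B_{cw}^H]$ the $nk\times nk$ basis matrix described in the context, let $$\begin{bmatrix} X_{cw}^P \\ X^N \\ X_{cw}^H \end{bmatrix}=(B_{cw})^{-1}(V_G)^T,$$ with $X_{cw}^P\in\mathbb{R}^{d_1}$, $X^N\in\mathbb{R}^{d_2}$, $X_{cw}^H\in\mathbb{R}^{d_3}$, where $d_1=k-1$, $d_2=\sum_{j=1}^n k/k_j$, $d_3=(n-1)k-\sum_{j=1}^n k/k_j+1$. Then: 1. the coset weighted pure potential projection of $G$ (onto $\mathcal{P}^{cw}$) is $(V_G^{P^{cw}})^T=B_{cw}\begin{bmatrix} X_{cw}^P \\ 0 \\ 0 \end{bmatrix}$; 2. the coset weighted pure harmonic projection of $G$ (onto $\mathcal{H}^{cw}$) is $(V_G^{H^{cw}})^T=B_{cw}\begin{bmatrix} 0 \\ 0 \\ X_{cw}^H \end{bmatrix}$; 3. the non-strategic projection of $G$ (onto $\mathcal{N}$) is $(V_G^{N})^T=B_{cw}\begin{bmatrix} 0 \\ X^N \\ 0 \end{bmatrix}$; 4. the coset weighted potential projection of $G$ (onto $\mathcal{G}_P^{cw}=\mathcal{P}^{cw}\oplus\mathcal{N}$) is $(V_{\mathcal{G}_P}^{cw})^T=(V_G^{P^{cw}})^T+(V_G^N)^T$; 5. the coset weighted harmonic projection of $G$ (onto $\mathcal{N}\oplus\mathcal{H}^{cw}$)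 is $(V_{\mathcal{G}_H}^{cw})^T=(V_G^{H^{cw}})^T+(V_G^N)^T$.
   Context: A finite normal form game $G$ has players $N=\{1,\dots,n\}$, strategy sets $S_i=\{1,\dots,k_i\}$ with $k_i\ge2$, $S=\prod_i S_i$, $S_{-i}=\prod_{j\ne i}S_j$, payoffs $c_i:S\to\mathbb{R}$. Put $k=\prod_j k_j$. $\delta_m^j$ is the $j$-th column of $I_m$; juxtaposition of column vectors is the Kronecker product. For a profile $s$ put $x_j=\delta_{k_j}^{s_j}$. The structure vector of $c_i$ is the row vector $V_i^c\in\mathbb{R}^k$ with $c_i(s)=V_i^c(x_1\otimes\cdots\otimes x_n)$, and $V_G=[V_1^c,\dots,V_n^c]$; $G$ is identified with $V_G^T\in\mathbb{R}^{nk}$. The row vector $V_i^w\in\mathbb{R}^{k/k_i}$ is defined by $w_i(s_{-i})=V_i^w\bigotimes_{j\ne i}x_j$ (factors in increasing order of $j$). $E_i:=I_{k_1\cdots k_{i-1}}\otimes\mathbf{1}_{k_i}\otimes I_{k_{i+1}\cdots k_n}$ ($\mathbf{1}_m$ all-ones column, empty products are $1$), and $\Lambda_i$ is the $k\times k$ diagonal matrix whose diagonal entries are the entries of $V_i^wE_i^T$. $B_{cw}^P\in\mathbb{R}^{nk\times k}$ is the vertical stack of the blocks $\Lambda_i-\frac1{k_i}\Lambda_iE_iE_i^T$, $i=1,\dots,n$; $B_{cw}^{P^0}$ is $B_{cw}^P$ with its last column deleted. $B^N$ is block diagonal with diagonal blocks $E_1,\dots,E_n$. $B_{cw}^H=[J_1,\dots,J_{n-1}]$,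 where $J_r$ ($1\le r\le n-1$) consists of the vectors in $\mathbb{R}^{nk}$, one for each $(i_1,\dots,i_n)\in\prod_p\{1,\dots,k_p\}$ with $i_{r+1}\ne1$ and $(i_1,\dots,i_r)\ne(1,\dots,1)$, whose $q$-th block ($1\le q\le r$) is $\Lambda_q^{-1}\,\delta_{k_1}^{i_1}\cdots\delta_{k_{q-1}}^{i_{q-1}}(\delta_{k_q}^1-\delta_{k_q}^{i_q})\delta_{k_{q+1}}^1\cdots\delta_{k_r}^1(\delta_{k_{r+1}}^1-\delta_{k_{r+1}}^{i_{r+1}})\delta_{k_{r+2}}^{i_{r+2}}\cdots\delta_{k_n}^{i_n}$, whose $(r+1)$-th block is $-\Lambda_{r+1}^{-1}(\delta_{k_1}^1\cdots\delta_{k_r}^1-\delta_{k_1}^{i_1}\cdots\delta_{k_r}^{i_r})(\delta_{k_{r+1}}^1-\delta_{k_{r+1}}^{i_{r+1}})\delta_{k_{r+2}}^{i_{r+2}}\cdots\delta_{k_n}^{i_n}$, and whose other blocks are zero. Subspaces: $\mathcal{P}^{cw}=\mathrm{Span}(B_{cw}^P)$ and $\mathcal{N}=\mathrm{Span}(B^N)$ (column spans); $\mathcal{G}_P^{cw}$ is the set of $V_G^T$ for which there is $P:S\to\mathbb{R}$ with $c_i(x,s_{-i})-c_i(y,s_{-i})=w_i(s_{-i})(P(x,s_{-i})-P(y,s_{-i}))$ for all $i,x,y,s_{-i}$; $\mathcal{H}^{cw}=(\mathcal{G}_P^{cw})^\perp$. Projections are orthogonal projections for the standard inner product, i.e. components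 in the orthogonal decomposition $\mathbb{R}^{nk}=\mathcal{P}^{cw}\oplus\mathcal{N}\oplus\mathcal{H}^{cw}$. *)

theory Defs
  imports
    Complex_Main
    "HOL-Library.FuncSet"
    "Jordan_Normal_Form.Gauss_Jordan_Elimination"
    "Jordan_Normal_Form.VS_Connect"
begin

text \<open>Players are numbered \<open>1..n\<close> and player \<open>j\<close> has the strategies \<open>1..k j\<close>.
  A (partial) profile of a set \<open>J\<close> of players is an element of a dependent function space over
  \<open>J\<close>. Vectors and matrices are the 0-based ones of the library, whereas players, strategies and
  superscripts of \<open>\<delta>\<close> are 1-based.\<close>

definition players :: "nat \<Rightarrow> nat set" where
  "players n = {1..n}"

definition others :: "nat \<Rightarrow> nat \<Rightarrow> nat set" where
  "others n i = players n - {i}"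

definition profiles :: "(nat \<Rightarrow> nat) \<Rightarrow> nat set \<Rightarrow> (nat \<Rightarrow> nat) set" where
  "profiles k J = (\<Pi>\<^sub>E j\<in>J. {1..k j})"

definition profile_count :: "nat \<Rightarrow> (nat \<Rightarrow> nat) \<Rightarrow> nat" where
  "profile_count n k = (\<Prod>j\<in>players n. k j)"

definition delta :: "nat \<Rightarrow> nat \<Rightarrow> real vec" where
  "delta m j = unit_vec m (j - 1)"

definition kron_vec :: "real vec \<Rightarrow> real vec \<Rightarrow> real vec" where
  "kron_vec u v =
     vec (dim_vec u * dim_vec v) (\<lambda>a. u $ (a div dim_vec v) * v $ (a mod dim_vec v))"

definition kron_vecs :: "real vec list \<Rightarrow> real vec" where
  "kron_vecs us = foldr kron_vec us (vec 1 (\<lambda>_. 1))"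

definition kron_mat :: "real mat \<Rightarrow> real mat \<Rightarrow> real mat" where
  "kron_mat A B =
     mat (dim_row A * dim_row B) (dim_col A * dim_col B)
       (\<lambda>(a, b). A $$ (a div dim_row B, b div dim_col B) * B $$ (a mod dim_row B, b mod dim_col B))"

definition mat_inv :: "real mat \<Rightarrow> real mat" where
  "mat_inv A = the (mat_inverse A)"

definition stack_vecs :: "real vec list \<Rightarrow> real vec" where
  "stack_vecs us = foldr append_vec us vNil"

text \<open>The structure vector of a function on the profiles of the players in \<open>J\<close>; the Kronecker
  factors are taken in increasing order of the players.\<close>

definition structure_vec :: "(nat \<Rightarrow> nat) \<Rightarrow> nat set \<Rightarrow> ((nat \<Rightarrow> nat) \<Rightarrow> real) \<Rightarrow> real vec" where
  "structure_vec k J f =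
     (THE v. v \<in> carrier_vec (\<Prod>j\<in>J. k j) \<and>
        (\<forall>s\<in>profiles k J.
           f s = v \<bullet> kron_vecs (map (\<lambda>j. delta (k j) (s j)) (sorted_list_of_set J))))"

definition game_vec :: "nat \<Rightarrow> (nat \<Rightarrow> nat) \<Rightarrow> (nat \<Rightarrow> (nat \<Rightarrow> nat) \<Rightarrow> real) \<Rightarrow> real vec" where
  "game_vec n k c = stack_vecs (map (\<lambda>i. structure_vec k (players n) (c i)) [1..<Suc n])"

definition E_mat :: "nat \<Rightarrow> (nat \<Rightarrow> nat) \<Rightarrow> nat \<Rightarrow> real mat" where
  "E_mat n k i =
     kron_mat (kron_mat (1\<^sub>m (\<Prod>j\<in>{1..<i}. k j)) (mat (k i) 1 (\<lambda>_. 1)))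
       (1\<^sub>m (\<Prod>j\<in>{i<..n}. k j))"

text \<open>The diagonal is the row vector \<open>V\<^sub>i\<^sup>w E\<^sub>i\<^sup>T\<close>, transposed.\<close>

definition Lambda_mat ::
  "nat \<Rightarrow> (nat \<Rightarrow> nat) \<Rightarrow> (nat \<Rightarrow> (nat \<Rightarrow> nat) \<Rightarrow> real) \<Rightarrow> nat \<Rightarrow> real mat" where
  "Lambda_mat n k w i =
     mat_diag (profile_count n k)
       (\<lambda>a. (E_mat n k i *\<^sub>v structure_vec k (others n i) (w i)) $ a)"

definition B_P ::
  "nat \<Rightarrow> (nat \<Rightarrow> nat) \<Rightarrow> (nat \<Rightarrow> (nat \<Rightarrow> nat) \<Rightarrow> real) \<Rightarrow> real mat" where
  "B_P n k w =
     foldr append_rows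
       (map (\<lambda>i. Lambda_mat n k w i
                  - (1 / real (k i)) \<cdot>\<^sub>m (Lambda_mat n k w i * E_mat n k i * (E_mat n k i)\<^sup>T))
          [1..<Suc n])
       (0\<^sub>m 0 (profile_count n k))"

definition B_P0 ::
  "nat \<Rightarrow> (nat \<Rightarrow> nat) \<Rightarrow> (nat \<Rightarrow> (nat \<Rightarrow> nat) \<Rightarrow> real) \<Rightarrow> real mat" where
  "B_P0 n k w = mat_of_cols (n * profile_count n k) (butlast (cols (B_P n k w)))"

definition B_N :: "nat \<Rightarrow> (nat \<Rightarrow> nat) \<Rightarrow> real mat" where
  "B_N n k = diag_block_mat (map (E_mat n k) [1..<Suc n])"

definition J_index :: "nat \<Rightarrow> (nat \<Rightarrow> nat) \<Rightarrow> nat \<Rightarrow> (nat \<Rightarrow> nat) set" where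
  "J_index n k r = {s \<in> profiles k (players n). s (Suc r) \<noteq> 1 \<and> \<not> (\<forall>p\<in>{1..r}. s p = 1)}"

definition J_vec ::
  "nat \<Rightarrow> (nat \<Rightarrow> nat) \<Rightarrow> (nat \<Rightarrow> (nat \<Rightarrow> nat) \<Rightarrow> real) \<Rightarrow> nat \<Rightarrow> (nat \<Rightarrow> nat) \<Rightarrow> real vec" where
  "J_vec n k w r s = stack_vecs (map (\<lambda>q.
     if q \<le> r then
       mat_inv (Lambda_mat n k w q) *\<^sub>v
         kron_vecs (
           map (\<lambda>p. delta (k p) (s p)) [1..<q]
           @ [delta (k q) 1 - delta (k q) (s q)]
           @ map (\<lambda>p. delta (k p) 1) [Suc q..<Suc r]
           @ [delta (k (Suc r)) 1 - delta (k (Suc r)) (s (Suc r))]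
           @ map (\<lambda>p. delta (k p) (s p)) [Suc (Suc r)..<Suc n])
     else if q = Suc r then
       - (mat_inv (Lambda_mat n k w q) *\<^sub>v
         kron_vecs (
           [kron_vecs (map (\<lambda>p. delta (k p) 1) [1..<Suc r])
              - kron_vecs (map (\<lambda>p. delta (k p) (s p)) [1..<Suc r])]
           @ [delta (k (Suc r)) 1 - delta (k (Suc r)) (s (Suc r))]
           @ map (\<lambda>p. delta (k p) (s p)) [Suc (Suc r)..<Suc n]))
     else 0\<^sub>v (profile_count n k)) [1..<Suc n])"

text \<open>The order of the columns within each block \<open>J\<^sub>r\<close> is arbitrary: it is given by a list
  \<open>js r\<close> that enumerates the index set of the block without repetition.\<close>

definition J_enumeration :: "nat \<Rightarrow> (nat \<Rightarrow> nat) \<Rightarrow> (nat \<Rightarrow> (nat \<Rightarrow> nat) list) \<Rightarrow> bool" where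
  "J_enumeration n k js \<longleftrightarrow> (\<forall>r\<in>{1..n - 1}. distinct (js r) \<and> set (js r) = J_index n k r)"

definition B_H ::
  "nat \<Rightarrow> (nat \<Rightarrow> nat) \<Rightarrow> (nat \<Rightarrow> (nat \<Rightarrow> nat) \<Rightarrow> real) \<Rightarrow> (nat \<Rightarrow> (nat \<Rightarrow> nat) list) \<Rightarrow> real mat" where
  "B_H n k w js =
     mat_of_cols (n * profile_count n k)
       (concat (map (\<lambda>r. map (J_vec n k w r) (js r)) [1..<n]))"

definition B_cw ::
  "nat \<Rightarrow> (nat \<Rightarrow> nat) \<Rightarrow> (nat \<Rightarrow> (nat \<Rightarrow> nat) \<Rightarrow> real) \<Rightarrow> (nat \<Rightarrow> (nat \<Rightarrow> nat) list) \<Rightarrow> real mat" where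
  "B_cw n k w js =
     mat_of_cols (n * profile_count n k)
       (cols (B_P0 n k w) @ cols (B_N n k) @ cols (B_H n k w js))"

definition dim_P :: "nat \<Rightarrow> (nat \<Rightarrow> nat) \<Rightarrow> nat" where
  "dim_P n k = profile_count n k - 1"

definition dim_N :: "nat \<Rightarrow> (nat \<Rightarrow> nat) \<Rightarrow> nat" where
  "dim_N n k = (\<Sum>j\<in>players n. profile_count n k div k j)"

text \<open>For \<open>n \<ge> 2\<close> and all \<open>k j \<ge> 2\<close> the divisions are exact and no subtraction truncates.\<close>

definition dim_H :: "nat \<Rightarrow> (nat \<Rightarrow> nat) \<Rightarrow> nat" where
  "dim_H n k = (n - 1) * profile_count n k - (\<Sum>j\<in>players n. profile_count n k div k j) + 1"

definition pure_potential_space ::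
  "nat \<Rightarrow> (nat \<Rightarrow> nat) \<Rightarrow> (nat \<Rightarrow> (nat \<Rightarrow> nat) \<Rightarrow> real) \<Rightarrow> real vec set" where
  "pure_potential_space n k w = vec_space.col_space (n * profile_count n k) (B_P n k w)"

definition nonstrategic_space :: "nat \<Rightarrow> (nat \<Rightarrow> nat) \<Rightarrow> real vec set" where
  "nonstrategic_space n k = vec_space.col_space (n * profile_count n k) (B_N n k)"

definition is_weighted_potential ::
  "nat \<Rightarrow> (nat \<Rightarrow> nat) \<Rightarrow> (nat \<Rightarrow> (nat \<Rightarrow> nat) \<Rightarrow> real) \<Rightarrow> (nat \<Rightarrow> (nat \<Rightarrow> nat) \<Rightarrow> real)
    \<Rightarrow> ((nat \<Rightarrow> nat) \<Rightarrow> real) \<Rightarrow> bool" where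
  "is_weighted_potential n k w c P \<longleftrightarrow>
     (\<forall>i\<in>players n. \<forall>x\<in>{1..k i}. \<forall>y\<in>{1..k i}. \<forall>s\<in>profiles k (others n i).
        c i (s(i := x)) - c i (s(i := y)) = w i s * (P (s(i := x)) - P (s(i := y))))"

definition potential_space ::
  "nat \<Rightarrow> (nat \<Rightarrow> nat) \<Rightarrow> (nat \<Rightarrow> (nat \<Rightarrow> nat) \<Rightarrow> real) \<Rightarrow> real vec set" where
  "potential_space n k w = {game_vec n k c | c. \<exists>P. is_weighted_potential n k w c P}"

definition pure_harmonic_space ::
  "nat \<Rightarrow> (nat \<Rightarrow> nat) \<Rightarrow> (nat \<Rightarrow> (nat \<Rightarrow> nat) \<Rightarrow> real) \<Rightarrow> real vec set" where
  "pure_harmonic_space n k w =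
     vec_module.orthogonal_complement (n * profile_count n k) (potential_space n k w)"

definition sum_space :: "real vec set \<Rightarrow> real vec set \<Rightarrow> real vec set" where
  "sum_space U W = {u + v | u v. u \<in> U \<and> v \<in> W}"

definition orth_proj :: "nat \<Rightarrow> real vec set \<Rightarrow> real vec \<Rightarrow> real vec" where
  "orth_proj m U v = (THE p. p \<in> U \<and> v - p \<in> vec_module.orthogonal_complement m U)"

end

theory Submission
  imports Defs
begin

text \<open>
  Ordering profiles by mixed radix turns vectors in \<open>\<real>\<^sup>n\<^sup>k\<close> into payoff tables.
  A table lies in \<open>\<P>\<^sup>c\<^sup>w\<close> iff its entries are \<open>w\<^sub>i (f - f\<^sub>i)\<close> for some \<open>f\<close>, where
  \<open>f\<^sub>i\<close> averages \<open>f\<close> over the strategies of player \<open>i\<close>, and in \<open>\<N>\<close> iff the \<open>i\<close>-th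
  payoff ignores the strategy of player \<open>i\<close>. Hence \<open>\<P>\<^sup>c\<^sup>w \<bottom> \<N>\<close> and the potential
  games are their sum; moreover a table is orthogonal to them as soon as every payoff sums to
  zero over the player's own strategies and \<open>\<Sum>\<^sub>i w\<^sub>i c\<^sub>i = 0\<close>. The columns of
  \<open>B\<^sub>c\<^sub>w\<^sup>H\<close> satisfy this by telescoping, and they are independent because the entry of block
  \<open>r + 1\<close> at the index of a column of \<open>J\<^sub>r\<close> vanishes on all other columns of
  \<open>J\<^sub>1, \<dots>, J\<^sub>r\<close>. Since a function that equals all its averages is constant, the
  columns of \<open>B\<^sub>c\<^sub>w\<^sup>P\<^sup>0\<close> are independent too. Counting columns shows that \<open>B\<^sub>c\<^sub>w\<close> is
  square; it is injective because its three groups of columns are mutually orthogonal, so the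
  coordinates of a game give its orthogonal components.
\<close>

section \<open>Mixed-radix indexing of profiles and Kronecker products\<close>

text \<open>The weights vary with the opponents' profile, so they cannot be divided out of a block
  as constants. The unweighted argument survives because \<open>w i\<close> ignores the strategy of
  player \<open>i\<close>: multiplication by it commutes with averaging over that strategy and
  preserves zero sums along it. The factor \<open>Lambda_mat\<close> in the potential columns and
  its inverse in the harmonic columns cancel in inner products. Squareness makes membership of the
  harmonic columns in H^cw enough: coordinates of an arbitrary game then exist without a separate
  spanning argument. Structure vectors and projections are definite descriptions and
  \<open>mat_inv\<close> is the value of an optional result, so each of them becomes usable only
  after existence and uniqueness are settled.\<close>

fun mixed_radix :: "(nat \<Rightarrow> nat) \<Rightarrow> nat list \<Rightarrow> (nat \<Rightarrow> nat) \<Rightarrow> nat" where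
  "mixed_radix k [] s = 0"
| "mixed_radix k (p # ps) s = (s p - 1) * prod_list (map k ps) + mixed_radix k ps s"

text \<open>Earlier players are the more significant digits, as the left factor is in
  \<open>kron_vec\<close>. Cutting the player list therefore splits an index into quotient and
  remainder, which is how Kronecker factors are separated later.\<close>

lemma mixed_radix_append: "mixed_radix k (ps @ qs) s = mixed_radix k ps s * prod_list (map k qs) + mixed_radix k qs s"
  by (induction ps) (auto simp: algebra_simps)

lemma mixed_radix_cong: "(\<And>p. p \<in> set ps \<Longrightarrow> s p = t p) \<Longrightarrow> mixed_radix k ps s = mixed_radix k ps t"
  by (induction ps) auto

lemma digit_pair_less:
  fixes a b :: nat
  assumes "a < A" "b < B"
  shows "a * B + b < A * B"
proof -
  have "a * B + b < Suc a * B" using assms by simp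
  also have "\<dots> \<le> A * B" using assms by (intro mult_right_mono) auto
  finally show ?thesis .
qed

lemma digit_pair_div:
  fixes a b :: nat
  assumes "b < B"
  shows "(a * B + b) div B = a"
  using assms by (simp add: div_mult_self3)

lemma mixed_radix_less:
  assumes "s \<in> profiles k J" "set ps \<subseteq> J"
  shows "mixed_radix k ps s < prod_list (map k ps)"
  using assms(2)
proof (induction ps)
  case (Cons p ps)
  then have "s p \<in> {1..k p}" using assms(1) by (auto simp: profiles_def)
  then have "s p - 1 < k p" by auto
  with Cons show ?case by (simp add: digit_pair_less)
qed simp

text \<open>Dividing by the radix of the tail recovers the leading digit. The two profiles may live
  over different player sets, so that a full profile can be compared with a profile of the opponents
  of one player.\<close>

lemma mixed_radix_eq_imp:
  assumes "s \<in> profiles k J" "t \<in> profiles k J'" "set ps \<subseteq> J" "set ps \<subseteq> J'"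
    and "mixed_radix k ps s = mixed_radix k ps t" "p \<in> set ps"
  shows "s p = t p"
  using assms(3-6)
proof (induction ps)
  case (Cons q qs)
  have less: "mixed_radix k qs s < prod_list (map k qs)" "mixed_radix k qs t < prod_list (map k qs)"
    using Cons.prems assms mixed_radix_less by auto
  then have "((s q - 1) * prod_list (map k qs) + mixed_radix k qs s) div prod_list (map k qs) = s q - 1"
    "((t q - 1) * prod_list (map k qs) + mixed_radix k qs t) div prod_list (map k qs) = t q - 1"
    by (simp_all only: digit_pair_div)
  then have e: "s q - 1 = t q - 1" using Cons.prems(3) by simp
  then have e2: "mixed_radix k qs s = mixed_radix k qs t" using Cons.prems(3) by simp
  \<comment> \<open>Strategies start at 1, so the truncated subtraction in the digits loses
    nothing.\<close>
  have "s q \<ge> 1" "t q \<ge> 1" using assms(1,2) Cons.prems(1,2) by (auto simp: profiles_def)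
  then have "s q = t q" using e by simp
  then show ?case using Cons.IH Cons.prems e2 by auto
qed simp

lemma finite_profiles [simp]: "finite J \<Longrightarrow> finite (profiles k J)"
  by (simp add: profiles_def finite_PiE)

lemma card_profiles: "finite J \<Longrightarrow> card (profiles k J) = prod k J"
  by (simp add: profiles_def card_PiE)

lemma profiles_eqI:
  assumes "s \<in> profiles k J" "t \<in> profiles k J" "\<And>p. p \<in> J \<Longrightarrow> s p = t p"
  shows "s = t"
  using assms unfolding profiles_def by (rule PiE_ext)

lemma prod_list_map_distinct: "distinct ps \<Longrightarrow> prod_list (map f ps) = prod f (set ps)"
  by (simp add: prod.distinct_set_conv_list)

lemma mixed_radix_bij:
  assumes "distinct ps"
  shows "bij_betw (mixed_radix k ps) (profiles k (set ps)) {..<prod_list (map k ps)}"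
proof -
  have inj: "inj_on (mixed_radix k ps) (profiles k (set ps))"
  proof (rule inj_onI)
    fix s t assume st: "s \<in> profiles k (set ps)" "t \<in> profiles k (set ps)" "mixed_radix k ps s = mixed_radix k ps t"
    show "s = t"
      using st mixed_radix_eq_imp[OF st(1,2) order_refl order_refl st(3)] by (blast intro: profiles_eqI)
  qed
  \<comment> \<open>Surjectivity by counting: the injective image and the target have the same
    finite cardinality.\<close>
  moreover have "mixed_radix k ps ` profiles k (set ps) = {..<prod_list (map k ps)}"
  proof (rule card_subset_eq)
    show "mixed_radix k ps ` profiles k (set ps) \<subseteq> {..<prod_list (map k ps)}"
      using mixed_radix_less by auto
    show "card (mixed_radix k ps ` profiles k (set ps)) = card {..<prod_list (map k ps)}"
      using inj assms by (simp add: card_image card_profiles prod_list_map_distinct)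
  qed simp
  ultimately show ?thesis by (simp add: bij_betw_def)
qed

lemma sum_mixed_radix:
  assumes "distinct ps"
  shows "(\<Sum>a<prod_list (map k ps). f a) = (\<Sum>s\<in>profiles k (set ps). f (mixed_radix k ps s))"
  by (rule sum.reindex_bij_betw[OF mixed_radix_bij[OF assms], symmetric])

lemma obtain_mixed_radix:
  assumes "distinct ps" "a < prod_list (map k ps)"
  obtains s where "s \<in> profiles k (set ps)" "mixed_radix k ps s = a"
  using mixed_radix_bij[OF assms(1), of k] assms(2) by (metis bij_betwE bij_betw_imp_surj_on image_iff lessThan_iff)

section \<open>Kronecker products of vectors and structure vectors\<close>

lemma dim_kron_vec [simp]: "dim_vec (kron_vec u v) = dim_vec u * dim_vec v"
  by (simp add: kron_vec_def)

lemma index_kron_vec: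
  assumes "a < dim_vec u" "b < dim_vec v"
  shows "kron_vec u v $ (a * dim_vec v + b) = u $ a * v $ b"
  using assms digit_pair_less[OF assms] by (simp add: kron_vec_def digit_pair_div)

lemma dim_kron_vecs [simp]: "dim_vec (kron_vecs us) = prod_list (map dim_vec us)"
  by (induction us) (auto simp: kron_vecs_def)

lemma kron_vecs_Cons: "kron_vecs (u # us) = kron_vec u (kron_vecs us)"
  by (simp add: kron_vecs_def)

lemma index_kron_vecs:
  assumes "s \<in> profiles k J" "set ps \<subseteq> J" "\<And>p. p \<in> set ps \<Longrightarrow> dim_vec (u p) = k p"
  shows "kron_vecs (map u ps) $ mixed_radix k ps s = (\<Prod>p\<leftarrow>ps. u p $ (s p - 1))"
  using assms(2,3)
proof (induction ps)
  case (Cons p ps)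
  have "map (dim_vec \<circ> u) ps = map k ps" using Cons.prems by simp
  then have d: "dim_vec (kron_vecs (map u ps)) = prod_list (map k ps)"
    by (simp only: dim_kron_vecs map_map)
  have "s p \<in> {1..k p}" using Cons.prems assms(1) by (auto simp: profiles_def)
  then have sp: "s p - 1 < dim_vec (u p)" using Cons.prems by auto
  have "mixed_radix k ps s < dim_vec (kron_vecs (map u ps))"
    unfolding d by (rule mixed_radix_less[OF assms(1)]) (use Cons.prems in auto)
  from index_kron_vec[OF sp this, unfolded d] Cons show ?case
    by (simp add: kron_vecs_Cons)
qed (simp add: kron_vecs_def)

lemma index_delta:
  assumes "x \<in> {1..m}" "y \<in> {1..m}"
  shows "delta m y $ (x - 1) = of_bool (x = y)"
proof -
  have "(x - 1 = y - 1) = (x = y)" using assms by auto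
  then show ?thesis using assms by (auto simp: delta_def)
qed

lemma dim_delta [simp]: "dim_vec (delta m j) = m"
  by (simp add: delta_def)

lemma prod_list_deltas:
  assumes "s \<in> profiles k J" "set ps \<subseteq> J" "\<And>p. p \<in> set ps \<Longrightarrow> t p \<in> {1..k p}"
  shows "(\<Prod>p\<leftarrow>ps. delta (k p) (t p) $ (s p - 1)) = of_bool (\<forall>p\<in>set ps. s p = t p)"
proof -
  have "(\<Prod>p\<leftarrow>ps. delta (k p) (t p) $ (s p - 1)) = (\<Prod>p\<leftarrow>ps. of_bool (s p = t p))"
  proof (intro arg_cong[of _ _ prod_list] map_cong refl)
    fix p assume p: "p \<in> set ps"
    then have "s p \<in> {1..k p}" using assms(1,2) by (auto simp: profiles_def)
    then show "delta (k p) (t p) $ (s p - 1) = of_bool (s p = t p)"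
      by (rule index_delta[OF _ assms(3)[OF p]])
  qed
  also have "\<dots> = of_bool (\<forall>p\<in>set ps. s p = t p)"
    by (induction ps) auto
  finally show ?thesis .
qed

lemma index_kron_deltas:
  assumes "s \<in> profiles k J" "set ps \<subseteq> J" "\<And>p. p \<in> set ps \<Longrightarrow> t p \<in> {1..k p}"
  shows "kron_vecs (map (\<lambda>p. delta (k p) (t p)) ps) $ mixed_radix k ps s = of_bool (\<forall>p\<in>set ps. s p = t p)"
proof -
  have "kron_vecs (map (\<lambda>p. delta (k p) (t p)) ps) $ mixed_radix k ps s
      = (\<Prod>p\<leftarrow>ps. delta (k p) (t p) $ (s p - 1))"
    by (rule index_kron_vecs[OF assms(1,2)]) simp
  then show ?thesis by (simp only: prod_list_deltas[OF assms])
qed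

text \<open>The product of the \<open>delta\<close> vectors is the unit vector at the index of
  \<open>t\<close>, so pairing with it reads off one coordinate. This links the defining equation of
  a structure vector with \<open>mixed_radix\<close>.\<close>

lemma scalar_prod_kron_deltas:
  assumes "distinct ps" "t \<in> profiles k (set ps)" "v \<in> carrier_vec (prod_list (map k ps))"
  shows "v \<bullet> kron_vecs (map (\<lambda>p. delta (k p) (t p)) ps) = v $ mixed_radix k ps t"
proof -
  let ?u = "kron_vecs (map (\<lambda>p. delta (k p) (t p)) ps)"
  have "v \<bullet> ?u = (\<Sum>a<prod_list (map k ps). v $ a * ?u $ a)"
    by (simp add: scalar_prod_def o_def lessThan_atLeast0)
  also have "\<dots> = (\<Sum>s\<in>profiles k (set ps). v $ mixed_radix k ps s * ?u $ mixed_radix k ps s)"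
    by (rule sum_mixed_radix[OF assms(1)])
  also have "\<dots> = (\<Sum>s\<in>profiles k (set ps). if s = t then v $ mixed_radix k ps t else 0)"
  proof (rule sum.cong)
    fix s assume s: "s \<in> profiles k (set ps)"
    have "(\<forall>p\<in>set ps. s p = t p) \<longleftrightarrow> s = t"
      using profiles_eqI[OF s assms(2)] by auto
    then show "v $ mixed_radix k ps s * ?u $ mixed_radix k ps s = (if s = t then v $ mixed_radix k ps t else 0)"
      using index_kron_deltas[OF s order_refl, of t] assms(2) by (auto simp: profiles_def PiE_iff)
  qed simp
  finally show ?thesis using assms(2) by simp
qed

text \<open>Resolves the definite description: under the index bijection the defining equations
  prescribe each coordinate exactly once, hence one and only one vector satisfies them.\<close>

lemma structure_vec:
  assumes "finite J"
  shows "structure_vec k J f \<in> carrier_vec (prod k J)"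
    and "s \<in> profiles k J \<Longrightarrow> structure_vec k J f $ mixed_radix k (sorted_list_of_set J) s = f s"
proof -
  let ?ps = "sorted_list_of_set J"
  have ps: "distinct ?ps" "set ?ps = J" using assms by auto
  have K: "prod_list (map k ?ps) = prod k J"
    using prod_list_map_distinct[OF ps(1)] ps(2) by simp
  define Q where "Q v \<longleftrightarrow> v \<in> carrier_vec (prod k J) \<and>
    (\<forall>s\<in>profiles k J. f s = v \<bullet> kron_vecs (map (\<lambda>j. delta (k j) (s j)) ?ps))" for v
  have Q: "Q v \<longleftrightarrow> v \<in> carrier_vec (prod k J) \<and> (\<forall>s\<in>profiles k J. v $ mixed_radix k ?ps s = f s)" for v
  proof (cases "v \<in> carrier_vec (prod k J)")
    case True
    then show ?thesis
      using scalar_prod_kron_deltas[OF ps(1), of _ k v] by (auto simp: Q_def K ps)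
  qed (simp add: Q_def)
  have bij: "bij_betw (mixed_radix k ?ps) (profiles k J) {..<prod k J}"
    using mixed_radix_bij[OF ps(1), of k] by (simp add: K ps)
  have "\<exists>!v. Q v"
  proof (rule ex1I)
    \<comment> \<open>The witness decodes an index to its profile and evaluates \<open>f\<close>
      there.\<close>
    show "Q (vec (prod k J) (\<lambda>a. f (the_inv_into (profiles k J) (mixed_radix k ?ps) a)))"
      unfolding Q using bij bij_betwE[OF bij] by (auto simp: bij_betw_def the_inv_into_f_f)
    fix v assume v: "Q v"
    show "v = vec (prod k J) (\<lambda>a. f (the_inv_into (profiles k J) (mixed_radix k ?ps) a))"
    proof (rule eq_vecI)
      fix a assume "a < dim_vec (vec (prod k J) (\<lambda>a. f (the_inv_into (profiles k J) (mixed_radix k ?ps) a)))"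
      then have a: "a < prod k J" by simp
      then obtain s where "s \<in> profiles k J" "mixed_radix k ?ps s = a"
        using bij_betw_imp_surj_on[OF bij] by (metis image_iff lessThan_iff)
      then show "v $ a = vec (prod k J) (\<lambda>a. f (the_inv_into (profiles k J) (mixed_radix k ?ps) a)) $ a"
        using v bij a by (auto simp: Q bij_betw_def the_inv_into_f_f)
    qed (use v in \<open>simp add: Q\<close>)
  qed
  then have "Q (structure_vec k J f)"
    unfolding structure_vec_def Q_def by (rule theI')
  then show "structure_vec k J f \<in> carrier_vec (prod k J)"
    "s \<in> profiles k J \<Longrightarrow> structure_vec k J f $ mixed_radix k ?ps s = f s"
    by (auto simp: Q)
qed

section \<open>Stacked vectors and block diagonal matrices\<close>

lemma stack_vecs_simps [simp]:
  "stack_vecs [] = vNil" "stack_vecs (u # us) = u @\<^sub>v stack_vecs us"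
  by (simp_all add: stack_vecs_def)

lemma dim_stack_vecs [simp]: "dim_vec (stack_vecs us) = sum_list (map dim_vec us)"
  by (induction us) auto

lemma index_stack_vecs:
  assumes "\<And>u. u \<in> set us \<Longrightarrow> dim_vec u = K" "q < length us" "b < K"
  shows "stack_vecs us $ (q * K + b) = us ! q $ b"
  using assms
proof (induction us arbitrary: q)
  case (Cons u us)
  have dims: "map dim_vec us = map (\<lambda>_. K) us" using Cons.prems by simp
  show ?case
  proof (cases q)
    case 0
    then show ?thesis using Cons.prems by simp
  next
    case (Suc q')
    have "q' * K + b < length us * K"
      using Cons.prems Suc by (intro digit_pair_less) auto
    then show ?thesis
      using Cons Suc by (simp add: dims sum_list_triv)
  qed
qed simp

lemma stack_vecs_carrier:
  assumes "\<And>i. i \<in> set is \<Longrightarrow> f i \<in> carrier_vec K"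
  shows "stack_vecs (map f is) \<in> carrier_vec (length is * K)"
  using assms by (induction "is") auto

lemma foldr_append_rows:
  assumes "\<And>i. i \<in> set is \<Longrightarrow> M i \<in> carrier_mat K N"
  shows "foldr append_rows (map M is) (0\<^sub>m 0 N) \<in> carrier_mat (length is * K) N"
    and "x \<in> carrier_vec N \<Longrightarrow>
      foldr append_rows (map M is) (0\<^sub>m 0 N) *\<^sub>v x = stack_vecs (map (\<lambda>i. M i *\<^sub>v x) is)"
proof -
  have *: "foldr append_rows (map M is) (0\<^sub>m 0 N) \<in> carrier_mat (length is * K) N \<and>
    (x \<in> carrier_vec N \<longrightarrow>
      foldr append_rows (map M is) (0\<^sub>m 0 N) *\<^sub>v x = stack_vecs (map (\<lambda>i. M i *\<^sub>v x) is))"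
    using assms
  proof (induction "is")
    case (Cons i "is")
    then show ?case
      using carrier_append_rows[of "M i" K N _ "length is * K"]
      by (auto simp: mat_mult_append[of _ K N _ "length is * K"])
  qed (auto intro!: eq_vecI)
  from * show "foldr append_rows (map M is) (0\<^sub>m 0 N) \<in> carrier_mat (length is * K) N" by simp
  from * show "x \<in> carrier_vec N \<Longrightarrow>
      foldr append_rows (map M is) (0\<^sub>m 0 N) *\<^sub>v x = stack_vecs (map (\<lambda>i. M i *\<^sub>v x) is)" by simp
qed

text \<open>Unequal block lengths are allowed because the block of player \<open>i\<close> in the
  coordinates for \<open>B_N\<close> has as many entries as the opponents of \<open>i\<close> have
  profiles.\<close>

lemma stack_vecs_split:
  assumes "x \<in> carrier_vec (sum_list (map d is))"
  shows "\<exists>us. length us = length is \<and> (\<forall>i<length is. us ! i \<in> carrier_vec (d (is ! i))) \<and> x = stack_vecs us"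
  using assms
proof (induction "is" arbitrary: x)
  case Nil
  then show ?case by (intro exI[of _ "[]"]) auto
next
  case (Cons i "is")
  let ?y = "vec_last x (sum_list (map d is))"
  obtain us where us: "length us = length is"
    "\<forall>j<length is. us ! j \<in> carrier_vec (d (is ! j))" "?y = stack_vecs us"
    using Cons.IH[of ?y] by auto
  have "x = stack_vecs (vec_first x (d i) # us)"
    using Cons.prems us(3) vec_first_last_append[of x "d i" "sum_list (map d is)"] by simp
  then show ?case
    using us by (intro exI[of _ "vec_first x (d i) # us"]) (auto simp: nth_Cons split: nat.split)
qed

lemma mult_diag_block_mat_stack:
  assumes "length us = length is" "\<And>j. j < length is \<Longrightarrow> us ! j \<in> carrier_vec (dim_col (M (is ! j)))"
  shows "diag_block_mat (map M is) *\<^sub>v stack_vecs us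
    = stack_vecs (map (\<lambda>j. M (is ! j) *\<^sub>v us ! j) [0..<length is])"
  using assms
proof (induction "is" arbitrary: us)
  case (Cons i "is")
  then obtain u us' where us: "us = u # us'" by (cases us) auto
  have u: "u \<in> carrier_vec (dim_col (M i))" using Cons.prems(2)[of 0] us by simp
  have us': "us' ! j \<in> carrier_vec (dim_col (M (is ! j)))" if "j < length is" for j
    using Cons.prems(2)[of "Suc j"] us that by simp
  have len: "length us' = length is" using Cons.prems us by simp
  have "map dim_vec us' = map (\<lambda>i. dim_col (M i)) is"
    using len us' by (intro nth_equalityI) auto
  then have su: "stack_vecs us' \<in> carrier_vec (dim_col (diag_block_mat (map M is)))"
    by (intro carrier_vecI) (simp add: dim_diag_block_mat o_def)
  let ?D = "diag_block_mat (map M is)"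
  have "diag_block_mat (map M (i # is)) *\<^sub>v stack_vecs us
      = (M i *\<^sub>v u + 0\<^sub>m (dim_row (M i)) (dim_col ?D) *\<^sub>v stack_vecs us')
        @\<^sub>v (0\<^sub>m (dim_row ?D) (dim_col (M i)) *\<^sub>v u + ?D *\<^sub>v stack_vecs us')"
    unfolding us list.map diag_block_mat.simps Let_def stack_vecs_simps
    by (rule four_block_mat_mult_vec[OF _ _ _ _ u su]) auto
  also have "0\<^sub>m (dim_row (M i)) (dim_col ?D) *\<^sub>v stack_vecs us' = 0\<^sub>v (dim_row (M i))"
    using su by (intro eq_vecI) auto
  also have "M i *\<^sub>v u + 0\<^sub>v (dim_row (M i)) = M i *\<^sub>v u"
    by (intro eq_vecI) auto
  also have "0\<^sub>m (dim_row ?D) (dim_col (M i)) *\<^sub>v u = 0\<^sub>v (dim_row ?D)"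
    using u by (intro eq_vecI) auto
  also have "0\<^sub>v (dim_row ?D) + ?D *\<^sub>v stack_vecs us' = ?D *\<^sub>v stack_vecs us'"
    by (intro eq_vecI) auto
  also have "?D *\<^sub>v stack_vecs us' = stack_vecs (map (\<lambda>j. M (is ! j) *\<^sub>v us' ! j) [0..<length is])"
    by (rule Cons.IH[OF len us'])
  also have "(M i *\<^sub>v u) @\<^sub>v \<dots> = stack_vecs (map (\<lambda>j. M ((i # is) ! j) *\<^sub>v us ! j) [0..<length (i # is)])"
    unfolding us by (simp add: upt_conv_Cons map_Suc_upt[symmetric] o_def del: upt_Suc map_Suc_upt)
  finally show ?case .
qed (auto intro!: eq_vecI)

section \<open>Blocks and entries of game vectors\<close>

lemma index_kron_mat:
  assumes "a < dim_row A" "b < dim_row B" "a' < dim_col A" "b' < dim_col B"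
  shows "kron_mat A B $$ (a * dim_row B + b, a' * dim_col B + b') = A $$ (a, a') * B $$ (b, b')"
  using assms digit_pair_less[OF assms(1,2)] digit_pair_less[OF assms(3,4)]
  by (simp add: kron_mat_def digit_pair_div)

lemma dim_kron_mat [simp]:
  "dim_row (kron_mat A B) = dim_row A * dim_row B"
  "dim_col (kron_mat A B) = dim_col A * dim_col B"
  by (simp_all add: kron_mat_def)

text \<open>The explicit inverse serves twice: it shows that \<open>mat_inverse\<close> succeeds,
  and then associativity forces the returned matrix to equal it.\<close>

lemma mat_inv_mat_diag:
  assumes "\<And>a. a < N \<Longrightarrow> d a \<noteq> 0"
  shows "mat_inv (mat_diag N d) = mat_diag N (\<lambda>a. 1 / d a)"
proof -
  let ?D = "mat_diag N d" and ?I = "mat_diag N (\<lambda>a. 1 / d a)"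
  have D: "?D \<in> carrier_mat N N" and I: "?I \<in> carrier_mat N N"
    by (auto simp: mat_diag_def)
  have one: "?D * ?I = 1\<^sub>m N" "?I * ?D = 1\<^sub>m N"
    using assms by (auto simp: mat_diag_mult_left[OF I] mat_diag_mult_left[OF D] intro!: eq_matI)
      (auto simp: mat_diag_def)
  then have "\<exists>x\<in>carrier_mat N N. x * ?D = 1\<^sub>m N \<and> ?D * x = 1\<^sub>m N"
    using I by blast
  then have "?D \<in> Units (ring_mat TYPE(real) N ())"
    using D by (simp add: Units_def ring_mat_def)
  then obtain B where B: "mat_inverse ?D = Some B"
    using mat_inverse(1)[OF D, where b = "()"] by (cases "mat_inverse ?D") auto
  from mat_inverse(2)[OF D B] have "B * ?D = 1\<^sub>m N" "B \<in> carrier_mat N N" by auto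
  then have "B * (?D * ?I) = ?I"
    using I by (simp only: assoc_mult_mat[OF \<open>B \<in> carrier_mat N N\<close> D I, symmetric] left_mult_one_mat)
  then have "B = ?I" using \<open>B \<in> carrier_mat N N\<close> by (simp only: one right_mult_one_mat)
  then show ?thesis by (simp add: mat_inv_def B)
qed

lemma mat_diag_mult_vec:
  assumes "u \<in> carrier_vec N" "a < N"
  shows "(mat_diag N d *\<^sub>v u) $ a = d a * u $ a"
proof -
  have "(mat_diag N d *\<^sub>v u) $ a = (\<Sum>j<N. (if a = j then d j else 0) * u $ j)"
    using assms by (simp add: mat_diag_def scalar_prod_def lessThan_atLeast0)
  also have "\<dots> = (\<Sum>j<N. if a = j then d a * u $ a else 0)"
    by (intro sum.cong) auto
  finally show ?thesis using assms by simp
qed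

section \<open>Profiles of all players and of the opponents of one player\<close>

lemma finite_players [simp]: "finite (players n)" "finite (others n i)"
  by (simp_all add: players_def others_def)

lemma sorted_list_of_players: "sorted_list_of_set (players n) = [1..<Suc n]"
  by (simp add: players_def atLeastLessThanSuc_atLeastAtMost[symmetric] del: upt_Suc)

lemma sorted_list_of_others:
  assumes "i \<in> players n"
  shows "sorted_list_of_set (others n i) = [1..<i] @ [Suc i..<Suc n]"
  using assms
  by (intro sorted_distinct_set_unique)
    (auto simp: players_def others_def sorted_append simp del: upt_Suc)

lemma upt_split_player: "i \<in> players n \<Longrightarrow> [1..<Suc n] = [1..<i] @ i # [Suc i..<Suc n]"
  using upt_add_eq_append[of 1 i "Suc n - i"] by (auto simp: players_def upt_conv_Cons simp del: upt_Suc)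

lemma set_players_list: "set [1..<Suc n] = players n"
  by (auto simp: players_def)

lemma prod_list_players: "prod_list (map k [1..<Suc n]) = profile_count n k"
  by (simp only: prod_list_map_distinct distinct_upt set_players_list profile_count_def)

lemma prod_list_above: "prod_list (map k [Suc i..<Suc n]) = (\<Prod>j\<in>{i<..n}. k j)"
  using prod_list_map_distinct[of "[Suc i..<Suc n]" k]
  by (simp add: atLeastLessThanSuc_atLeastAtMost atLeastSucAtMost_greaterThanAtMost del: upt_Suc)

lemma prod_list_below: "prod_list (map k [1..<i]) = (\<Prod>j\<in>{1..<i}. k j)"
  using prod_list_map_distinct[of "[1..<i]" k] by simp

lemma profile_count_others: "i \<in> players n \<Longrightarrow> profile_count n k = k i * prod k (others n i)"
  by (simp add: profile_count_def others_def prod.remove)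

lemma prod_others_split:
  assumes "i \<in> players n"
  shows "prod k (others n i) = (\<Prod>j\<in>{1..<i}. k j) * (\<Prod>j\<in>{i<..n}. k j)"
proof -
  have "others n i = {1..<i} \<union> {i<..n}" using assms by (auto simp: others_def players_def)
  then show ?thesis by (simp only: prod.union_disjoint[of "{1..<i}" "{i<..n}"] finite_atLeastLessThan
        finite_greaterThanAtMost) (subst prod.union_disjoint; auto)
qed

lemma restrict_others: "s \<in> profiles k (players n) \<Longrightarrow> restrict s (others n i) \<in> profiles k (others n i)"
  by (auto simp: profiles_def others_def)

lemma others_upd:
  "i \<in> players n \<Longrightarrow> t \<in> profiles k (others n i) \<Longrightarrow> x \<in> {1..k i} \<Longrightarrow> t(i := x) \<in> profiles k (players n)"
  by (auto simp: profiles_def others_def PiE_iff extensional_def)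

lemma players_upd:
  "i \<in> players n \<Longrightarrow> s \<in> profiles k (players n) \<Longrightarrow> x \<in> {1..k i} \<Longrightarrow> s(i := x) \<in> profiles k (players n)"
  by (auto simp: profiles_def PiE_iff extensional_def)

lemma restrict_others_upd:
  "i \<in> players n \<Longrightarrow> s \<in> profiles k (players n) \<Longrightarrow> (restrict s (others n i))(i := x) = s(i := x)"
  by (auto simp: profiles_def others_def fun_eq_iff PiE_iff extensional_def)

lemma restrict_upd_others [simp]: "restrict (s(i := x)) (others n i) = restrict s (others n i)"
  by (auto simp: others_def fun_eq_iff)

lemma restrict_upd_others_id: "t \<in> profiles k (others n i) \<Longrightarrow> restrict (t(i := x)) (others n i) = t"
  by (auto simp: profiles_def others_def fun_eq_iff PiE_iff extensional_def)

definition profile_index :: "nat \<Rightarrow> (nat \<Rightarrow> nat) \<Rightarrow> (nat \<Rightarrow> nat) \<Rightarrow> nat" where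
  "profile_index n k s = mixed_radix k [1..<Suc n] s"

definition others_index :: "nat \<Rightarrow> (nat \<Rightarrow> nat) \<Rightarrow> nat \<Rightarrow> (nat \<Rightarrow> nat) \<Rightarrow> nat" where
  "others_index n k i s = mixed_radix k (sorted_list_of_set (others n i)) s"

lemma profile_index_less: "s \<in> profiles k (players n) \<Longrightarrow> profile_index n k s < profile_count n k"
  unfolding profile_index_def prod_list_players[symmetric] by (rule mixed_radix_less) (auto simp only: set_players_list)

lemma obtain_profile_index:
  assumes "a < profile_count n k"
  obtains s where "s \<in> profiles k (players n)" "profile_index n k s = a"
  using obtain_mixed_radix[of "[1..<Suc n]" a k] assms
  by (simp only: profile_index_def prod_list_players distinct_upt set_players_list) blast

lemma sum_profile_index: "(\<Sum>a<profile_count n k. f a) = (\<Sum>s\<in>profiles k (players n). f (profile_index n k s))"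
  using sum_mixed_radix[of "[1..<Suc n]" f k]
  by (simp only: profile_index_def prod_list_players distinct_upt set_players_list)

lemma prod_list_others: "prod_list (map k (sorted_list_of_set (others n i))) = prod k (others n i)"
  by (simp add: prod_list_map_distinct)

lemma others_index_less: "s \<in> profiles k J \<Longrightarrow> others n i \<subseteq> J \<Longrightarrow> others_index n k i s < prod k (others n i)"
  unfolding others_index_def prod_list_others[symmetric] by (rule mixed_radix_less) simp_all

lemma obtain_others_index:
  assumes "a < prod k (others n i)"
  obtains s where "s \<in> profiles k (others n i)" "others_index n k i s = a"
  using obtain_mixed_radix[of "sorted_list_of_set (others n i)" a k] assms
  by (auto simp: others_index_def prod_list_others)

lemma sum_others_index: "(\<Sum>a<prod k (others n i). f a) = (\<Sum>s\<in>profiles k (others n i). f (others_index n k i s))"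
  using sum_mixed_radix[of "sorted_list_of_set (others n i)" f k] by (simp add: others_index_def prod_list_others)

lemma others_index_restrict [simp]: "others_index n k i (restrict s (others n i)) = others_index n k i s"
  unfolding others_index_def by (rule mixed_radix_cong) simp

lemma E_mat_carrier: "i \<in> players n \<Longrightarrow> E_mat n k i \<in> carrier_mat (profile_count n k) (prod k (others n i))"
  by (rule carrier_matI) (simp_all add: E_mat_def profile_count_others prod_others_split)

text \<open>\<open>E_mat\<close> is the incidence matrix of forgetting the strategy of player
  \<open>i\<close>. The index of \<open>s\<close> has a part below \<open>i\<close>, the digit of
  \<open>i\<close> and a part above; the identity factors compare the outer parts, and the all-ones
  column ignores the middle digit.\<close>

lemma E_mat_index:
  assumes i: "i \<in> players n" and s: "s \<in> profiles k (players n)" and t: "t \<in> profiles k (others n i)"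
  shows "E_mat n k i $$ (profile_index n k s, others_index n k i t) = (if restrict s (others n i) = t then 1 else 0)"
proof -
  let ?A = "\<Prod>j\<in>{1..<i}. k j" and ?C = "\<Prod>j\<in>{i<..n}. k j"
  let ?lo = "[1..<i]" and ?hi = "[Suc i..<Suc n]"
  have sub: "set ?lo \<subseteq> players n" "set ?hi \<subseteq> players n" "set ?lo \<subseteq> others n i" "set ?hi \<subseteq> others n i"
    using i by (auto simp: players_def others_def)
  have a: "mixed_radix k ?lo s < ?A" "mixed_radix k ?lo t < ?A"
    using mixed_radix_less[OF s sub(1)] mixed_radix_less[OF t sub(3)] by (simp_all only: prod_list_below)
  have c: "mixed_radix k ?hi s < ?C" "mixed_radix k ?hi t < ?C"
    using mixed_radix_less[OF s sub(2)] mixed_radix_less[OF t sub(4)] by (simp_all only: prod_list_above)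
  have si: "s i - 1 < k i" using s i by (force simp: profiles_def PiE_iff)
  \<comment> \<open>Regrouped to match the nesting of the Kronecker product: the lower part and the
    own digit together form a row index of the inner factor.\<close>
  have p: "profile_index n k s = (mixed_radix k ?lo s * k i + (s i - 1)) * ?C + mixed_radix k ?hi s"
    unfolding profile_index_def upt_split_player[OF i] mixed_radix_append mixed_radix.simps list.map prod_list.Cons prod_list_above
    by (simp add: algebra_simps)
  have o: "others_index n k i t = mixed_radix k ?lo t * ?C + mixed_radix k ?hi t"
    unfolding others_index_def sorted_list_of_others[OF i] mixed_radix_append prod_list_above ..
  let ?M = "kron_mat (1\<^sub>m ?A) (mat (k i) 1 (\<lambda>_. 1))"
  have "E_mat n k i $$ (profile_index n k s, others_index n k i t)
      = ?M $$ (mixed_radix k ?lo s * k i + (s i - 1), mixed_radix k ?lo t) * 1\<^sub>m ?C $$ (mixed_radix k ?hi s, mixed_radix k ?hi t)"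
    unfolding E_mat_def p o
    using index_kron_mat[of "mixed_radix k ?lo s * k i + (s i - 1)" ?M "mixed_radix k ?hi s" "1\<^sub>m ?C" "mixed_radix k ?lo t" "mixed_radix k ?hi t"]
      a c si digit_pair_less[OF a(1) si] by simp
  \<comment> \<open>The all-ones factor has a single column, so the column index of
    \<open>?M\<close> is read as the lower index times 1 plus 0.\<close>
  also have "?M $$ (mixed_radix k ?lo s * k i + (s i - 1), mixed_radix k ?lo t) = 1\<^sub>m ?A $$ (mixed_radix k ?lo s, mixed_radix k ?lo t)"
    using index_kron_mat[of "mixed_radix k ?lo s" "1\<^sub>m ?A" "s i - 1" "mat (k i) 1 (\<lambda>_. 1)" "mixed_radix k ?lo t" 0] a si
    by simp
  also have "1\<^sub>m ?A $$ (mixed_radix k ?lo s, mixed_radix k ?lo t) * 1\<^sub>m ?C $$ (mixed_radix k ?hi s, mixed_radix k ?hi t)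
      = (if mixed_radix k ?lo s = mixed_radix k ?lo t \<and> mixed_radix k ?hi s = mixed_radix k ?hi t then 1 else (0::real))"
    using a c by simp
  also have "mixed_radix k ?lo s = mixed_radix k ?lo t \<and> mixed_radix k ?hi s = mixed_radix k ?hi t \<longleftrightarrow> restrict s (others n i) = t"
  proof
    assume "mixed_radix k ?lo s = mixed_radix k ?lo t \<and> mixed_radix k ?hi s = mixed_radix k ?hi t"
    then have "s p = t p" if "p \<in> set ?lo \<union> set ?hi" for p
      using mixed_radix_eq_imp[OF s t sub(1,3), of p] mixed_radix_eq_imp[OF s t sub(2,4), of p] that by blast
    moreover have "set ?lo \<union> set ?hi = others n i" using i by (auto simp: players_def others_def)
    ultimately have "s p = t p" if "p \<in> others n i" for p using that by blast
    then show "restrict s (others n i) = t"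
      by (intro profiles_eqI[OF restrict_others[OF s] t]) simp
  next
    assume "restrict s (others n i) = t"
    then have "s p = t p" if "p \<in> others n i" for p using that by auto
    then show "mixed_radix k ?lo s = mixed_radix k ?lo t \<and> mixed_radix k ?hi s = mixed_radix k ?hi t"
      using sub by (intro conjI mixed_radix_cong) blast+
  qed
  finally show ?thesis .
qed

text \<open>Multiplying by \<open>E_mat\<close> lifts a function of the opponents' profile to all
  profiles; its transpose, treated next, sums over the fibres instead.\<close>

lemma E_mat_mult:
  assumes i: "i \<in> players n" and s: "s \<in> profiles k (players n)" and v: "v \<in> carrier_vec (prod k (others n i))"
  shows "(E_mat n k i *\<^sub>v v) $ profile_index n k s = v $ others_index n k i s"
proof -
  have "(E_mat n k i *\<^sub>v v) $ profile_index n k s = (\<Sum>a<prod k (others n i). E_mat n k i $$ (profile_index n k s, a) * v $ a)"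
    using E_mat_carrier[OF i, of k] v profile_index_less[OF s] by (simp add: scalar_prod_def lessThan_atLeast0)
  also have "\<dots> = (\<Sum>t\<in>profiles k (others n i). if restrict s (others n i) = t then v $ others_index n k i s else 0)"
    unfolding sum_others_index by (intro sum.cong) (auto simp: E_mat_index[OF i s])
  also have "\<dots> = v $ others_index n k i s" using restrict_others[OF s] by simp
  finally show ?thesis .
qed

lemma E_mat_transpose_mult:
  assumes i: "i \<in> players n" and t: "t \<in> profiles k (others n i)" and x: "x \<in> carrier_vec (profile_count n k)"
  shows "((E_mat n k i)\<^sup>T *\<^sub>v x) $ others_index n k i t = (\<Sum>y\<in>{1..k i}. x $ profile_index n k (t(i := y)))"
proof -
  have "((E_mat n k i)\<^sup>T *\<^sub>v x) $ others_index n k i t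
      = (\<Sum>a<profile_count n k. E_mat n k i $$ (a, others_index n k i t) * x $ a)"
    using E_mat_carrier[OF i, of k] x others_index_less[OF t order_refl]
    by (simp add: scalar_prod_def lessThan_atLeast0)
  also have "\<dots> = (\<Sum>s\<in>profiles k (players n). if restrict s (others n i) = t then x $ profile_index n k s else 0)"
    unfolding sum_profile_index by (intro sum.cong) (auto simp: E_mat_index[OF i _ t])
  also have "\<dots> = (\<Sum>s\<in>{s\<in>profiles k (players n). restrict s (others n i) = t}. x $ profile_index n k s)"
    by (simp add: sum.inter_filter)
  \<comment> \<open>The fibre over \<open>t\<close> consists of its extensions by a strategy of
    player \<open>i\<close>; a given \<open>s\<close> arises from the strategy
    \<open>s i\<close>.\<close>
  also have "{s\<in>profiles k (players n). restrict s (others n i) = t} = (\<lambda>y. t(i := y)) ` {1..k i}"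
  proof safe
    fix s assume s: "s \<in> profiles k (players n)" and "t = restrict s (others n i)"
    then show "s \<in> (\<lambda>y. (restrict s (others n i))(i := y)) ` {1..k i}"
      using i by (intro image_eqI[of _ _ "s i"])
        (auto simp: restrict_others_upd[OF i s] profiles_def PiE_iff)
  qed (use others_upd[OF i t] restrict_upd_others_id[OF t] in auto)
  also have "(\<Sum>s\<in>(\<lambda>y. t(i := y)) ` {1..k i}. x $ profile_index n k s) = (\<Sum>y\<in>{1..k i}. x $ profile_index n k (t(i := y)))"
    by (rule sum.reindex_cong[OF _ refl refl]) (auto simp: inj_on_def dest: fun_upd_eqD)
  finally show ?thesis .
qed

text \<open>Turns a vector into a payoff table. Blocks are numbered from 0 and players from 1, hence
  the shift.\<close>

definition entry :: "nat \<Rightarrow> (nat \<Rightarrow> nat) \<Rightarrow> real vec \<Rightarrow> nat \<Rightarrow> (nat \<Rightarrow> nat) \<Rightarrow> real" where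
  "entry n k v i s = v $ ((i - 1) * profile_count n k + profile_index n k s)"

lemma entry_index_less:
  "i \<in> players n \<Longrightarrow> s \<in> profiles k (players n) \<Longrightarrow>
    (i - 1) * profile_count n k + profile_index n k s < n * profile_count n k"
  by (rule digit_pair_less) (auto simp: players_def profile_index_less)

lemma entry_eqI:
  assumes "u \<in> carrier_vec (n * profile_count n k)" "v \<in> carrier_vec (n * profile_count n k)"
    and "\<And>i s. i \<in> players n \<Longrightarrow> s \<in> profiles k (players n) \<Longrightarrow> entry n k u i s = entry n k v i s"
  shows "u = v"
proof (rule eq_vecI)
  fix a assume "a < dim_vec v"
  then have a: "a < n * profile_count n k" using assms by simp
  then have "profile_count n k > 0" by (cases "profile_count n k") auto
  then have "a mod profile_count n k < profile_count n k" by simp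
  then obtain s where s: "s \<in> profiles k (players n)" "profile_index n k s = a mod profile_count n k"
    by (rule obtain_profile_index)
  have "Suc (a div profile_count n k) \<in> players n"
    using a by (simp add: players_def Suc_le_eq less_mult_imp_div_less)
  from assms(3)[OF this s(1)] show "u $ a = v $ a"
    by (simp add: entry_def s(2) del: div_mult_mod_eq) (simp only: div_mult_mod_eq)
qed (use assms in auto)

lemma entry_stack:
  assumes "\<And>j. j \<in> players n \<Longrightarrow> f j \<in> carrier_vec (profile_count n k)"
    and "i \<in> players n" "s \<in> profiles k (players n)"
  shows "entry n k (stack_vecs (map f [1..<Suc n])) i s = f i $ profile_index n k s"
proof -
  have "stack_vecs (map f [1..<Suc n]) $ ((i - 1) * profile_count n k + profile_index n k s)
      = map f [1..<Suc n] ! (i - 1) $ profile_index n k s"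
    by (rule index_stack_vecs)
      (use assms profile_index_less in \<open>auto simp: players_def simp del: upt_Suc\<close>)
  moreover have "map f [1..<Suc n] ! (i - 1) = f i"
    using assms(2) nth_map_upt[of "i - 1" "Suc n" 1 f] by (auto simp: players_def simp del: upt_Suc)
  ultimately show ?thesis by (simp add: entry_def)
qed

lemma stack_players_carrier:
  assumes "\<And>j. j \<in> players n \<Longrightarrow> f j \<in> carrier_vec (profile_count n k)"
  shows "stack_vecs (map f [1..<Suc n]) \<in> carrier_vec (n * profile_count n k)"
  using stack_vecs_carrier[of "[1..<Suc n]" f "profile_count n k"] assms
  by (simp only: set_players_list length_upt diff_Suc_1)

text \<open>Positions of a game vector are pairs of a block and a profile index, so the sum is
  grouped by blocks. The dimension is imposed on \<open>v\<close> because the second argument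
  determines the range of the library's scalar product.\<close>

lemma scalar_prod_entries:
  assumes "v \<in> carrier_vec (n * profile_count n k)"
  shows "u \<bullet> v = (\<Sum>i\<in>players n. \<Sum>s\<in>profiles k (players n). entry n k u i s * entry n k v i s)"
proof -
  let ?K = "profile_count n k"
  have "u \<bullet> v = (\<Sum>a<n * ?K. u $ a * v $ a)"
    using assms by (simp add: scalar_prod_def lessThan_atLeast0)
  also have "\<dots> = (\<Sum>q<n. \<Sum>a\<in>{q * ?K..<q * ?K + ?K}. u $ a * v $ a)"
    by (rule sum.nat_group[symmetric])
  also have "\<dots> = (\<Sum>q<n. \<Sum>b<?K. u $ (q * ?K + b) * v $ (q * ?K + b))"
  proof (rule sum.cong[OF refl])
    fix q
    show "(\<Sum>a\<in>{q * ?K..<q * ?K + ?K}. u $ a * v $ a)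
        = (\<Sum>b<?K. u $ (q * ?K + b) * v $ (q * ?K + b))"
      using sum.shift_bounds_nat_ivl[of "\<lambda>a. u $ a * v $ a" 0 "q * ?K" ?K]
      by (simp only: lessThan_atLeast0 add_0 add.commute[of "q * ?K"])
  qed
  also have "\<dots> = (\<Sum>q<n. \<Sum>s\<in>profiles k (players n). entry n k u (Suc q) s * entry n k v (Suc q) s)"
    by (simp add: sum_profile_index entry_def)
  finally show ?thesis by (simp add: players_def sum.atLeast1_atMost_eq)
qed

lemma entry_linear:
  assumes "u \<in> carrier_vec (n * profile_count n k)" "v \<in> carrier_vec (n * profile_count n k)"
    and "i \<in> players n" "s \<in> profiles k (players n)"
  shows "entry n k (u + v) i s = entry n k u i s + entry n k v i s"
    and "entry n k (u - v) i s = entry n k u i s - entry n k v i s"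
  using assms entry_index_less[OF assms(3,4)] by (simp_all add: entry_def)

lemma entry_zero:
  "i \<in> players n \<Longrightarrow> s \<in> profiles k (players n) \<Longrightarrow> entry n k (0\<^sub>v (n * profile_count n k)) i s = 0"
  using entry_index_less by (simp add: entry_def)

section \<open>Potential, non-strategic and harmonic games\<close>

lemma map_players_cong:
  assumes "\<And>i. i \<in> players n \<Longrightarrow> f i = g i"
  shows "map f [1..<Suc n] = map g [1..<Suc n]"
  using assms by (intro map_cong refl) (simp only: set_players_list)

lemma smult_mat_mult_vec:
  fixes A :: "real mat"
  shows "A \<in> carrier_mat r c \<Longrightarrow> x \<in> carrier_vec c \<Longrightarrow> (a \<cdot>\<^sub>m A) *\<^sub>v x = a \<cdot>\<^sub>v (A *\<^sub>v x)"
  by (intro eq_vecI) (auto simp: scalar_prod_def sum_distrib_left mult.assoc)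

lemma sum_profiles_split:
  assumes i: "i \<in> players n"
  shows "(\<Sum>s\<in>profiles k (players n). F s) = (\<Sum>t\<in>profiles k (others n i). \<Sum>y\<in>{1..k i}. F (t(i := y)))"
proof -
  have pl: "players n = insert i (others n i)" and ni: "i \<notin> others n i"
    using i by (auto simp: others_def)
  have "profiles k (players n) = (\<lambda>(y, t). t(i := y)) ` ({1..k i} \<times> profiles k (others n i))"
    unfolding profiles_def pl PiE_insert_eq ..
  moreover have "inj_on (\<lambda>(y, t). t(i := y)) ({1..k i} \<times> profiles k (others n i))"
    unfolding profiles_def by (rule inj_combinator[OF ni])
  ultimately have "(\<Sum>s\<in>profiles k (players n). F s)
      = (\<Sum>(y, t)\<in>{1..k i} \<times> profiles k (others n i). F (t(i := y)))"
    by (simp add: sum.reindex case_prod_unfold)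
  also have "\<dots> = (\<Sum>y\<in>{1..k i}. \<Sum>t\<in>profiles k (others n i). F (t(i := y)))"
    by (rule sum.cartesian_product[symmetric])
  also have "\<dots> = (\<Sum>t\<in>profiles k (others n i). \<Sum>y\<in>{1..k i}. F (t(i := y)))"
    by (rule sum.swap)
  finally show ?thesis .
qed

text \<open>Both orthogonality arguments below rest on this: on each line in direction
  \<open>i\<close> the factor \<open>g\<close> is constant and leaves the sum, and what remains is a
  zero sum of \<open>h\<close>.\<close>

lemma sum_invariant_times_zero_sum:
  fixes g h :: "(nat \<Rightarrow> nat) \<Rightarrow> real"
  assumes i: "i \<in> players n" and k: "k i > 0"
    and g: "\<And>s x. s \<in> profiles k (players n) \<Longrightarrow> x \<in> {1..k i} \<Longrightarrow> g (s(i := x)) = g s"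
    and h: "\<And>s. s \<in> profiles k (players n) \<Longrightarrow> (\<Sum>y\<in>{1..k i}. h (s(i := y))) = 0"
  shows "(\<Sum>s\<in>profiles k (players n). g s * h s) = 0"
  unfolding sum_profiles_split[OF i]
proof (rule sum.neutral, rule ballI)
  fix t assume t: "t \<in> profiles k (others n i)"
  have s: "t(i := 1) \<in> profiles k (players n)" using others_upd[OF i t] k by simp
  have "(\<Sum>y\<in>{1..k i}. g (t(i := y)) * h (t(i := y))) = (\<Sum>y\<in>{1..k i}. g (t(i := 1)) * h (t(i := y)))"
  proof (rule sum.cong[OF refl])
    fix y assume "y \<in> {1..k i}"
    then have "g (t(i := y)) = g (t(i := 1))" using g[OF s, of y] by (simp only: fun_upd_upd)
    then show "g (t(i := y)) * h (t(i := y)) = g (t(i := 1)) * h (t(i := y))" by (simp only:)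
  qed
  also have "\<dots> = 0" using h[OF s] by (simp add: sum_distrib_left[symmetric])
  finally show "(\<Sum>y\<in>{1..k i}. g (t(i := y)) * h (t(i := y))) = 0" .
qed

locale weighted_profiles =
  fixes n :: nat and k :: "nat \<Rightarrow> nat" and w :: "nat \<Rightarrow> (nat \<Rightarrow> nat) \<Rightarrow> real"
  assumes two_players: "n \<ge> 2"
    and two_strategies: "i \<in> players n \<Longrightarrow> k i \<ge> 2"
    and w_pos: "i \<in> players n \<Longrightarrow> t \<in> profiles k (others n i) \<Longrightarrow> w i t > 0"
begin

abbreviation "K \<equiv> profile_count n k"
abbreviation "S \<equiv> profiles k (players n)"
abbreviation "ix \<equiv> profile_index n k"
abbreviation "ent \<equiv> entry n k"
abbreviation "wt i s \<equiv> w i (restrict s (others n i))"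
abbreviation "\<Lambda> \<equiv> Lambda_mat n k w"
abbreviation "E \<equiv> E_mat n k"
abbreviation "PP \<equiv> pure_potential_space n k w"
abbreviation "NN \<equiv> nonstrategic_space n k"
abbreviation "HH \<equiv> pure_harmonic_space n k w"
abbreviation "GP \<equiv> potential_space n k w"

lemma k_pos: "i \<in> players n \<Longrightarrow> k i > 0"
  using two_strategies[of i] by simp

lemma wt_pos: "i \<in> players n \<Longrightarrow> s \<in> S \<Longrightarrow> wt i s > 0"
  by (rule w_pos[OF _ restrict_others])

lemma K_pos: "K > 0"
  unfolding profile_count_def by (rule prod_pos) (simp add: k_pos)

definition as_vec :: "((nat \<Rightarrow> nat) \<Rightarrow> real) \<Rightarrow> real vec" where
  "as_vec f = structure_vec k (players n) f"

lemma as_vec_carrier [simp]: "as_vec f \<in> carrier_vec K"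
  unfolding as_vec_def profile_count_def by (rule structure_vec(1)) simp

lemma as_vec_index [simp]: "s \<in> S \<Longrightarrow> as_vec f $ ix s = f s"
  using structure_vec(2)[of "players n" s k f]
  by (simp only: as_vec_def profile_index_def sorted_list_of_players finite_players)

section \<open>Weights, means and the blocks of the potential matrix\<close>

lemma Lambda_diag:
  assumes "i \<in> players n" "s \<in> S"
  shows "(E i *\<^sub>v structure_vec k (others n i) (w i)) $ ix s = wt i s"
proof -
  have "(E i *\<^sub>v structure_vec k (others n i) (w i)) $ ix s
      = structure_vec k (others n i) (w i) $ others_index n k i (restrict s (others n i))"
    using E_mat_mult[OF assms structure_vec(1)] by simp
  then show ?thesis
    using structure_vec(2)[OF finite_players(2) restrict_others[OF assms(2)]] by (simp add: others_index_def)
qed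

lemma Lambda_mat_carrier: "\<Lambda> i \<in> carrier_mat K K"
  by (simp add: Lambda_mat_def mat_diag_def)

lemma Lambda_mult:
  assumes "i \<in> players n" "s \<in> S" "u \<in> carrier_vec K"
  shows "(\<Lambda> i *\<^sub>v u) $ ix s = wt i s * u $ ix s"
  unfolding Lambda_mat_def using assms
  by (simp add: mat_diag_mult_vec profile_index_less Lambda_diag)

lemma Lambda_inv:
  assumes "i \<in> players n"
  shows "mat_inv (\<Lambda> i) = mat_diag K (\<lambda>a. 1 / (E i *\<^sub>v structure_vec k (others n i) (w i)) $ a)"
  unfolding Lambda_mat_def
proof (rule mat_inv_mat_diag)
  fix a assume "a < K"
  then obtain s where s: "s \<in> S" "ix s = a" by (rule obtain_profile_index)
  then show "(E i *\<^sub>v structure_vec k (others n i) (w i)) $ a \<noteq> 0"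
    using Lambda_diag[OF assms s(1)] wt_pos[OF assms s(1)] by simp
qed

lemma Lambda_inv_carrier: "i \<in> players n \<Longrightarrow> mat_inv (\<Lambda> i) \<in> carrier_mat K K"
  by (simp add: Lambda_inv mat_diag_def)

lemma Lambda_inv_mult:
  assumes "i \<in> players n" "s \<in> S" "u \<in> carrier_vec K"
  shows "(mat_inv (\<Lambda> i) *\<^sub>v u) $ ix s = u $ ix s / wt i s"
  unfolding Lambda_inv[OF assms(1)] using assms
  by (simp add: mat_diag_mult_vec profile_index_less Lambda_diag)

text \<open>On functions of profiles this is \<open>E i\<close> times its transpose, divided by
  \<open>k i\<close>: the orthogonal projection onto the functions that ignore player
  \<open>i\<close>.\<close>

definition mean :: "nat \<Rightarrow> ((nat \<Rightarrow> nat) \<Rightarrow> real) \<Rightarrow> (nat \<Rightarrow> nat) \<Rightarrow> real" where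
  "mean i f s = (1 / real (k i)) * (\<Sum>y\<in>{1..k i}. f (s(i := y)))"

lemma mean_upd [simp]: "mean i f (s(i := x)) = mean i f s"
  by (simp add: mean_def)

lemma sum_diff_mean:
  "i \<in> players n \<Longrightarrow> (\<Sum>y\<in>{1..k i}. f (s(i := y)) - mean i f s) = 0"
  using k_pos[of i] by (simp add: sum_subtractf mean_def)

lemma E_Et_mult:
  assumes "i \<in> players n" "s \<in> S" "x \<in> carrier_vec K"
  shows "(E i *\<^sub>v ((E i)\<^sup>T *\<^sub>v x)) $ ix s = (\<Sum>y\<in>{1..k i}. x $ ix (s(i := y)))"
proof -
  have "(E i)\<^sup>T *\<^sub>v x \<in> carrier_vec (prod k (others n i))"
    using E_mat_carrier[OF assms(1), of k] assms(3) by (intro mult_mat_vec_carrier) auto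
  then have "(E i *\<^sub>v ((E i)\<^sup>T *\<^sub>v x)) $ ix s
      = ((E i)\<^sup>T *\<^sub>v x) $ others_index n k i (restrict s (others n i))"
    using E_mat_mult[OF assms(1,2)] by simp
  also have "\<dots> = (\<Sum>y\<in>{1..k i}. x $ ix ((restrict s (others n i))(i := y)))"
    by (rule E_mat_transpose_mult[OF assms(1) restrict_others[OF assms(2)] assms(3)])
  finally show ?thesis by (simp add: restrict_others_upd[OF assms(1,2)])
qed

abbreviation "P_block i \<equiv> \<Lambda> i - (1 / real (k i)) \<cdot>\<^sub>m (\<Lambda> i * E i * (E i)\<^sup>T)"

lemma P_block_carrier: "i \<in> players n \<Longrightarrow> P_block i \<in> carrier_mat K K"
  using E_mat_carrier[of i n k]
  by (intro minus_carrier_mat smult_carrier_mat mult_carrier_mat[OF mult_carrier_mat[OF Lambda_mat_carrier]]) auto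

text \<open>After reassociation the matrix product acts one factor at a time: sum over the own
  strategies, lift back to full profiles, multiply by the weight.\<close>

lemma P_block_mult:
  assumes i: "i \<in> players n" and s: "s \<in> S" and x: "x \<in> carrier_vec K"
  shows "(P_block i *\<^sub>v x) $ ix s = wt i s * (x $ ix s - mean i (\<lambda>s. x $ ix s) s)"
proof -
  note L = Lambda_mat_carrier[of i] and Ec = E_mat_carrier[OF i, of k]
  then have LE: "\<Lambda> i * E i \<in> carrier_mat K (prod k (others n i))"
    and Et: "(E i)\<^sup>T \<in> carrier_mat (prod k (others n i)) K" by auto
  have Etx: "(E i)\<^sup>T *\<^sub>v x \<in> carrier_vec (prod k (others n i))"
    by (rule mult_mat_vec_carrier[OF Et x])
  have y: "E i *\<^sub>v ((E i)\<^sup>T *\<^sub>v x) \<in> carrier_vec K"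
    by (rule mult_mat_vec_carrier[OF Ec Etx])
  have "P_block i *\<^sub>v x = \<Lambda> i *\<^sub>v x - ((1 / real (k i)) \<cdot>\<^sub>m (\<Lambda> i * E i * (E i)\<^sup>T)) *\<^sub>v x"
    using L LE Et x by (intro minus_mult_distrib_mat_vec[of _ K K]) auto
  also have "((1 / real (k i)) \<cdot>\<^sub>m (\<Lambda> i * E i * (E i)\<^sup>T)) *\<^sub>v x
      = (1 / real (k i)) \<cdot>\<^sub>v (\<Lambda> i *\<^sub>v (E i *\<^sub>v ((E i)\<^sup>T *\<^sub>v x)))"
    using smult_mat_mult_vec[OF mult_carrier_mat[OF LE Et] x] assoc_mult_mat_vec[OF LE Et x]
      assoc_mult_mat_vec[OF L Ec Etx] by (simp only:)
  finally have eq: "P_block i *\<^sub>v x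
      = \<Lambda> i *\<^sub>v x - (1 / real (k i)) \<cdot>\<^sub>v (\<Lambda> i *\<^sub>v (E i *\<^sub>v ((E i)\<^sup>T *\<^sub>v x)))" .
  have dim: "dim_vec (\<Lambda> i *\<^sub>v (E i *\<^sub>v ((E i)\<^sup>T *\<^sub>v x))) = K" using L by simp
  show ?thesis
    unfolding eq
    using dim profile_index_less[OF s] Lambda_mult[OF i s x] Lambda_mult[OF i s y] E_Et_mult[OF i s x]
    by (simp add: mean_def algebra_simps)
qed

lemma B_P_carrier: "B_P n k w \<in> carrier_mat (n * K) K"
  using foldr_append_rows(1)[of "[1..<Suc n]" "\<lambda>i. P_block i" K K] P_block_carrier
  by (simp only: B_P_def set_players_list length_upt diff_Suc_1)

lemma entry_B_P:
  assumes "i \<in> players n" "s \<in> S" "x \<in> carrier_vec K"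
  shows "ent (B_P n k w *\<^sub>v x) i s = wt i s * (x $ ix s - mean i (\<lambda>s. x $ ix s) s)"
proof -
  have "B_P n k w *\<^sub>v x = stack_vecs (map (\<lambda>i. P_block i *\<^sub>v x) [1..<Suc n])"
    unfolding B_P_def
    by (rule foldr_append_rows(2)[where K = K, OF _ assms(3)]) (simp only: set_players_list P_block_carrier)
  then show ?thesis
    using P_block_mult[OF assms] entry_stack[of n "\<lambda>i. P_block i *\<^sub>v x" k i s]
      mult_mat_vec_carrier[OF P_block_carrier assms(3)] assms(1,2) by simp
qed

text \<open>The coefficients of a column combination are the values of a function on profiles, so
  functions \<open>f\<close> parametrise the column space. Adding a constant to \<open>f\<close>
  changes nothing, which is why one column of \<open>B_P\<close> gets deleted.\<close>

lemma pure_potential_space_iff: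
  "v \<in> PP \<longleftrightarrow> v \<in> carrier_vec (n * K) \<and>
    (\<exists>f. \<forall>i\<in>players n. \<forall>s\<in>S. ent v i s = wt i s * (f s - mean i f s))"
    (is "_ \<longleftrightarrow> ?R")
proof -
  have PP: "v \<in> PP \<longleftrightarrow> v \<in> carrier_vec (n * K) \<and> (\<exists>x\<in>carrier_vec K. B_P n k w *\<^sub>v x = v)"
    using B_P_carrier by (auto simp: pure_potential_space_def vec_space.col_space_eq[OF B_P_carrier])
  show ?thesis
  proof
    assume "v \<in> PP"
    then obtain x where x: "x \<in> carrier_vec K" "v = B_P n k w *\<^sub>v x" "v \<in> carrier_vec (n * K)"
      using PP by auto
    then show ?R using entry_B_P by (intro conjI exI[of _ "\<lambda>s. x $ ix s"]) auto
  next
    assume R: ?R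
    then obtain f where f: "\<And>i s. i \<in> players n \<Longrightarrow> s \<in> S \<Longrightarrow> ent v i s = wt i s * (f s - mean i f s)"
      by auto
    have "B_P n k w *\<^sub>v as_vec f = v"
    proof (rule entry_eqI)
      fix i s assume iS: "i \<in> players n" "s \<in> S"
      have "mean i (\<lambda>s. as_vec f $ ix s) s = mean i f s"
        unfolding mean_def using players_upd[OF iS] by simp
      then show "ent (B_P n k w *\<^sub>v as_vec f) i s = ent v i s"
        using entry_B_P[OF iS as_vec_carrier] f[OF iS] iS by simp
    qed (use R mult_mat_vec_carrier[OF B_P_carrier as_vec_carrier] in auto)
    then show "v \<in> PP" using PP R as_vec_carrier by blast
  qed
qed

lemma dim_N_eq_sum: "dim_N n k = (\<Sum>i\<in>players n. prod k (others n i))"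
  unfolding dim_N_def by (rule sum.cong) (auto simp: profile_count_others dest: k_pos)

lemma dim_N_eq: "dim_N n k = sum_list (map (\<lambda>i. prod k (others n i)) [1..<Suc n])"
  by (simp only: dim_N_eq_sum sum_list_distinct_conv_sum_set distinct_upt set_players_list)

lemma B_N_carrier: "B_N n k \<in> carrier_mat (n * K) (dim_N n k)"
proof (rule carrier_matI)
  have "map (dim_row \<circ> E) [1..<Suc n] = map (\<lambda>_. K) [1..<Suc n]"
    by (rule map_players_cong) (use E_mat_carrier[of _ n k] in auto)
  then have "sum_list (map (dim_row \<circ> E) [1..<Suc n]) = n * K"
    by (simp only: sum_list_triv length_upt of_nat_id diff_Suc_1)
  then show "dim_row (B_N n k) = n * K"
    by (simp only: B_N_def dim_diag_block_mat map_map)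
  have "map (dim_col \<circ> E) [1..<Suc n] = map (\<lambda>i. prod k (others n i)) [1..<Suc n]"
    by (rule map_players_cong) (use E_mat_carrier[of _ n k] in auto)
  then show "dim_col (B_N n k) = dim_N n k"
    by (simp only: B_N_def dim_diag_block_mat map_map dim_N_eq)
qed

lemma stack_others_carrier:
  assumes "\<And>i. i \<in> players n \<Longrightarrow> y i \<in> carrier_vec (prod k (others n i))"
  shows "stack_vecs (map y [1..<Suc n]) \<in> carrier_vec (dim_N n k)"
proof (rule carrier_vecI)
  have "map (dim_vec \<circ> y) [1..<Suc n] = map (\<lambda>i. prod k (others n i)) [1..<Suc n]"
    by (rule map_players_cong) (use assms in auto)
  then show "dim_vec (stack_vecs (map y [1..<Suc n])) = dim_N n k"
    by (simp only: dim_stack_vecs map_map dim_N_eq)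
qed

lemma split_others:
  assumes "x \<in> carrier_vec (dim_N n k)"
  obtains y where "\<And>i. i \<in> players n \<Longrightarrow> y i \<in> carrier_vec (prod k (others n i))"
    "x = stack_vecs (map y [1..<Suc n])"
proof -
  obtain us where us: "length us = length [1..<Suc n]" "x = stack_vecs us"
    "\<And>j. j < length [1..<Suc n] \<Longrightarrow> us ! j \<in> carrier_vec (prod k (others n ([1..<Suc n] ! j)))"
    using stack_vecs_split[of x "\<lambda>i. prod k (others n i)" "[1..<Suc n]"] assms dim_N_eq by auto
  have "us = map (\<lambda>i. us ! (i - 1)) [1..<Suc n]"
    by (rule nth_equalityI) (use us(1) in \<open>auto simp del: upt_Suc\<close>)
  moreover have "us ! (i - 1) \<in> carrier_vec (prod k (others n i))" if "i \<in> players n" for i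
    using us(3)[of "i - 1"] that nth_upt[of 1 "i - 1" "Suc n"] by (auto simp: players_def simp del: upt_Suc)
  ultimately show ?thesis using us(2) that by metis
qed

lemma entry_B_N:
  assumes "\<And>i. i \<in> players n \<Longrightarrow> y i \<in> carrier_vec (prod k (others n i))"
    and "i \<in> players n" "s \<in> S"
  shows "ent (B_N n k *\<^sub>v stack_vecs (map y [1..<Suc n])) i s = y i $ others_index n k i s"
proof -
  have "B_N n k *\<^sub>v stack_vecs (map y [1..<Suc n])
      = stack_vecs (map (\<lambda>j. E ([1..<Suc n] ! j) *\<^sub>v map y [1..<Suc n] ! j) [0..<length [1..<Suc n]])"
    unfolding B_N_def
  proof (rule mult_diag_block_mat_stack)
    fix j assume "j < length [1..<Suc n]"
    then have j: "[1..<Suc n] ! j \<in> players n" using nth_mem set_players_list by blast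
    then show "map y [1..<Suc n] ! j \<in> carrier_vec (dim_col (E ([1..<Suc n] ! j)))"
      using assms(1)[OF j] E_mat_carrier[OF j, of k] \<open>j < _\<close> by (simp del: upt_Suc)
  qed simp
  also have "map (\<lambda>j. E ([1..<Suc n] ! j) *\<^sub>v map y [1..<Suc n] ! j) [0..<length [1..<Suc n]]
      = map (\<lambda>i. E i *\<^sub>v y i) [1..<Suc n]"
    by (rule nth_equalityI) (simp_all del: upt_Suc)
  finally show ?thesis
    using entry_stack[of n "\<lambda>i. E i *\<^sub>v y i" k i s] assms E_mat_mult[OF assms(2,3) assms(1)]
      mult_mat_vec_carrier[OF E_mat_carrier] by simp
qed

lemma nonstrategic_space_iff:
  "v \<in> NN \<longleftrightarrow> v \<in> carrier_vec (n * K) \<and>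
    (\<forall>i\<in>players n. \<forall>s\<in>S. \<forall>x\<in>{1..k i}. ent v i (s(i := x)) = ent v i s)"
    (is "_ \<longleftrightarrow> ?R")
proof -
  have NN: "v \<in> NN \<longleftrightarrow> v \<in> carrier_vec (n * K) \<and> (\<exists>x\<in>carrier_vec (dim_N n k). B_N n k *\<^sub>v x = v)"
    using B_N_carrier by (auto simp: nonstrategic_space_def vec_space.col_space_eq[OF B_N_carrier])
  show ?thesis
  proof
    assume "v \<in> NN"
    then obtain x where x: "x \<in> carrier_vec (dim_N n k)" "v = B_N n k *\<^sub>v x" "v \<in> carrier_vec (n * K)"
      using NN by auto
    obtain y where y: "\<And>i. i \<in> players n \<Longrightarrow> y i \<in> carrier_vec (prod k (others n i))"
      "x = stack_vecs (map y [1..<Suc n])" using split_others[OF x(1)] by blast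
    have v: "ent v i s = y i $ others_index n k i s" if "i \<in> players n" "s \<in> S" for i s
      using entry_B_N[OF y(1) that] x(2) y(2) by simp
    have "ent v i (s(i := a)) = ent v i s" if i: "i \<in> players n" and s: "s \<in> S" and a: "a \<in> {1..k i}" for i s a
      using v[OF i s] v[OF i players_upd[OF i s a]] by (metis others_index_restrict restrict_upd_others)
    then show ?R using x(3) by blast
  next
    assume R: ?R
    \<comment> \<open>A coset function is recovered by letting player \<open>i\<close> play the
      representative strategy 1; invariance makes the choice immaterial.\<close>
    define y where "y i = structure_vec k (others n i) (\<lambda>t. ent v i (t(i := 1)))" for i
    have y: "y i \<in> carrier_vec (prod k (others n i))" for i
      unfolding y_def by (rule structure_vec(1)) simp
    have "B_N n k *\<^sub>v stack_vecs (map y [1..<Suc n]) = v"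
    proof (rule entry_eqI)
      fix i s assume iS: "i \<in> players n" "s \<in> S"
      have "ent (B_N n k *\<^sub>v stack_vecs (map y [1..<Suc n])) i s
          = y i $ others_index n k i (restrict s (others n i))"
        using entry_B_N[OF y iS] by simp
      also have "\<dots> = ent v i ((restrict s (others n i))(i := 1))"
        using structure_vec(2)[OF finite_players(2) restrict_others[OF iS(2)]]
        by (simp add: y_def others_index_def)
      also have "\<dots> = ent v i s"
        using R iS k_pos[OF iS(1)] by (simp add: restrict_others_upd[OF iS])
      finally show "ent (B_N n k *\<^sub>v stack_vecs (map y [1..<Suc n])) i s = ent v i s" .
    qed (use R mult_mat_vec_carrier[OF B_N_carrier stack_others_carrier[OF y]] in auto)
    then show "v \<in> NN" using NN R stack_others_carrier[OF y] by blast
  qed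
qed

lemma game_vec_carrier: "game_vec n k c \<in> carrier_vec (n * K)"
  unfolding game_vec_def by (rule stack_players_carrier) (use as_vec_carrier in \<open>simp add: as_vec_def\<close>)

lemma entry_game_vec: "i \<in> players n \<Longrightarrow> s \<in> S \<Longrightarrow> ent (game_vec n k c) i s = c i s"
  unfolding game_vec_def
  using entry_stack[of n "\<lambda>i. as_vec (c i)" k i s] by (simp add: as_vec_def[symmetric] del: upt_Suc)

text \<open>The pair \<open>x\<close>, \<open>y\<close> of the definition becomes a change from the
  current strategy \<open>s i\<close> to \<open>x\<close>, so that the condition speaks of full
  profiles and fits \<open>entry\<close>.\<close>

lemma potential_space_iff:
  "v \<in> GP \<longleftrightarrow> v \<in> carrier_vec (n * K) \<and>
    (\<exists>P. \<forall>i\<in>players n. \<forall>s\<in>S. \<forall>x\<in>{1..k i}.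
      ent v i (s(i := x)) - ent v i s = wt i s * (P (s(i := x)) - P s))"
    (is "_ \<longleftrightarrow> ?R")
proof
  assume "v \<in> GP"
  then obtain c P where v: "v = game_vec n k c" and cP: "is_weighted_potential n k w c P"
    by (auto simp: potential_space_def)
  have "ent v i (s(i := x)) - ent v i s = wt i s * (P (s(i := x)) - P s)"
    if i: "i \<in> players n" and s: "s \<in> S" and x: "x \<in> {1..k i}" for i s x
  proof -
    have "s i \<in> {1..k i}" using i s by (auto simp: profiles_def)
    then have "c i ((restrict s (others n i))(i := x)) - c i ((restrict s (others n i))(i := s i))
      = wt i s * (P ((restrict s (others n i))(i := x)) - P ((restrict s (others n i))(i := s i)))"
      using cP i x restrict_others[OF s] unfolding is_weighted_potential_def by blast
    then show ?thesis
      using entry_game_vec[OF i] s players_upd[OF i s x] by (simp add: v restrict_others_upd[OF i s])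
  qed
  then show ?R using game_vec_carrier v by blast
next
  assume R: ?R
  then obtain P where P: "\<And>i s x. i \<in> players n \<Longrightarrow> s \<in> S \<Longrightarrow> x \<in> {1..k i} \<Longrightarrow>
      ent v i (s(i := x)) - ent v i s = wt i s * (P (s(i := x)) - P s)" by blast
  have "is_weighted_potential n k w (ent v) P"
    unfolding is_weighted_potential_def
  proof (intro ballI)
    fix i x y t assume i: "i \<in> players n" and x: "x \<in> {1..k i}" and y: "y \<in> {1..k i}"
      and t: "t \<in> profiles k (others n i)"
    show "ent v i (t(i := x)) - ent v i (t(i := y)) = w i t * (P (t(i := x)) - P (t(i := y)))"
      using P[OF i others_upd[OF i t y] x] restrict_upd_others_id[OF t, of y] by simp
  qed
  moreover have "v = game_vec n k (ent v)"
    by (rule entry_eqI[of _ n k]) (use R game_vec_carrier entry_game_vec in auto)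
  ultimately show "v \<in> GP" unfolding potential_space_def by blast
qed

text \<open>A game with potential \<open>P\<close> differs from the pure potential game built from
  \<open>P\<close> by payoffs that do not react to own deviations, because the mean term ignores
  them. Conversely, the function behind a pure potential game is itself a potential, also after
  adding a non-strategic game.\<close>

lemma potential_space_eq_sum: "GP = sum_space PP NN"
proof (intro equalityI subsetI)
  fix v assume v: "v \<in> GP"
  then have vc: "v \<in> carrier_vec (n * K)" using potential_space_iff by blast
  obtain P where P: "\<And>i s x. i \<in> players n \<Longrightarrow> s \<in> S \<Longrightarrow> x \<in> {1..k i} \<Longrightarrow>
      ent v i (s(i := x)) - ent v i s = wt i s * (P (s(i := x)) - P s)"
    using v potential_space_iff by blast
  define p where "p = game_vec n k (\<lambda>i s. wt i s * (P s - mean i P s))"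
  have pc: "p \<in> carrier_vec (n * K)" unfolding p_def by (rule game_vec_carrier)
  have ep: "ent p i s = wt i s * (P s - mean i P s)" if "i \<in> players n" "s \<in> S" for i s
    unfolding p_def using entry_game_vec[OF that] .
  then have "p \<in> PP" using pc pure_potential_space_iff by blast
  moreover have "v - p \<in> NN"
    unfolding nonstrategic_space_iff
  proof (intro conjI ballI)
    fix i s x assume i: "i \<in> players n" and s: "s \<in> S" and x: "x \<in> {1..k i}"
    have s': "s(i := x) \<in> S" by (rule players_upd[OF i s x])
    show "ent (v - p) i (s(i := x)) = ent (v - p) i s"
      using P[OF i s x] unfolding entry_linear(2)[OF vc pc i s'] entry_linear(2)[OF vc pc i s]
        ep[OF i s'] ep[OF i s] mean_upd restrict_upd_others by (simp add: algebra_simps)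
  qed (use vc pc in simp)
  moreover have "v = p + (v - p)" using vc pc by auto
  ultimately show "v \<in> sum_space PP NN" unfolding sum_space_def by blast
next
  fix v assume "v \<in> sum_space PP NN"
  then obtain p q where v: "v = p + q" "p \<in> PP" "q \<in> NN" by (auto simp: sum_space_def)
  obtain f where f: "\<And>i s. i \<in> players n \<Longrightarrow> s \<in> S \<Longrightarrow> ent p i s = wt i s * (f s - mean i f s)"
    using v(2) pure_potential_space_iff by blast
  have c: "p \<in> carrier_vec (n * K)" "q \<in> carrier_vec (n * K)"
    using v pure_potential_space_iff nonstrategic_space_iff by blast+
  have "ent v i (s(i := x)) - ent v i s = wt i s * (f (s(i := x)) - f s)"
    if i: "i \<in> players n" and s: "s \<in> S" and x: "x \<in> {1..k i}" for i s x
  proof -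
    have s': "s(i := x) \<in> S" by (rule players_upd[OF i s x])
    have "ent q i (s(i := x)) = ent q i s" using v(3) nonstrategic_space_iff i s x by blast
    then show ?thesis
      unfolding v(1) entry_linear(1)[OF c i s] entry_linear(1)[OF c i s'] f[OF i s] f[OF i s']
        mean_upd restrict_upd_others by (simp add: algebra_simps)
  qed
  then show "v \<in> GP" using c v(1) potential_space_iff by auto
qed

lemma pure_potential_orth_nonstrategic:
  assumes "p \<in> PP" "q \<in> NN"
  shows "q \<bullet> p = 0"
proof -
  obtain f where f: "\<And>i s. i \<in> players n \<Longrightarrow> s \<in> S \<Longrightarrow> ent p i s = wt i s * (f s - mean i f s)"
    using assms(1) pure_potential_space_iff by blast
  have "p \<in> carrier_vec (n * K)" using assms(1) pure_potential_space_iff by blast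
  then have "q \<bullet> p = (\<Sum>i\<in>players n. \<Sum>s\<in>S. ent q i s * ent p i s)"
    by (rule scalar_prod_entries)
  \<comment> \<open>Player by player: \<open>q\<close> ignores the own strategy, while
    \<open>p\<close> sums to zero over it, since deviations from a mean add up to zero and the
    weight is constant along the line.\<close>
  also have "\<dots> = 0"
  proof (rule sum.neutral, rule ballI, rule sum_invariant_times_zero_sum)
    fix i s assume i: "i \<in> players n" and s: "s \<in> S"
    have "(\<Sum>y\<in>{1..k i}. ent p i (s(i := y))) = (\<Sum>y\<in>{1..k i}. wt i s * (f (s(i := y)) - mean i f s))"
      using f[OF i players_upd[OF i s]] by (intro sum.cong) auto
    then show "(\<Sum>y\<in>{1..k i}. ent p i (s(i := y))) = 0"
      using sum_diff_mean[OF i, of f s] by (simp add: sum_distrib_left[symmetric])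
  qed (use assms(2) nonstrategic_space_iff k_pos in blast)+
  finally show ?thesis .
qed

text \<open>The payoff of player \<open>i\<close> in a potential game is the weight times
  \<open>f\<close> plus a part that ignores the strategy of \<open>i\<close>. The zero sums remove
  the second part; after exchanging the sums over players and profiles, the balance condition
  removes the first.\<close>

lemma pure_harmonicI:
  assumes v: "v \<in> carrier_vec (n * K)"
    and zero_sum: "\<And>i s. i \<in> players n \<Longrightarrow> s \<in> S \<Longrightarrow> (\<Sum>y\<in>{1..k i}. ent v i (s(i := y))) = 0"
    and balanced: "\<And>s. s \<in> S \<Longrightarrow> (\<Sum>i\<in>players n. wt i s * ent v i s) = 0"
  shows "v \<in> HH"
proof -
  have "v \<bullet> u = 0" if u: "u \<in> GP" for u
  proof -
    obtain p q where pq: "u = p + q" "p \<in> PP" "q \<in> NN"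
      using u unfolding potential_space_eq_sum sum_space_def by auto
    obtain f where f: "\<And>i s. i \<in> players n \<Longrightarrow> s \<in> S \<Longrightarrow> ent p i s = wt i s * (f s - mean i f s)"
      using pq(2) pure_potential_space_iff by blast
    have c: "p \<in> carrier_vec (n * K)" "q \<in> carrier_vec (n * K)"
      using pq pure_potential_space_iff nonstrategic_space_iff by blast+
    have "u \<bullet> v = (\<Sum>i\<in>players n. \<Sum>s\<in>S. ent u i s * ent v i s)"
      by (rule scalar_prod_entries[OF v])
    \<comment> \<open>The mean term moves from the potential summand to the non-strategic one, since
      both ignore the own strategy.\<close>
    also have "\<dots> = (\<Sum>i\<in>players n. (\<Sum>s\<in>S. f s * (wt i s * ent v i s))
        + (\<Sum>s\<in>S. (ent q i s - wt i s * mean i f s) * ent v i s))"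
      by (simp add: pq(1) entry_linear[OF c] f sum.distrib[symmetric] algebra_simps)
    also have "\<dots> = (\<Sum>i\<in>players n. \<Sum>s\<in>S. f s * (wt i s * ent v i s))"
    proof (rule sum.cong[OF refl])
      fix i assume i: "i \<in> players n"
      have "(\<Sum>s\<in>S. (ent q i s - wt i s * mean i f s) * ent v i s) = 0"
      proof (rule sum_invariant_times_zero_sum[where i = i])
        fix s x assume "s \<in> S" "x \<in> {1..k i}"
        then have "ent q i (s(i := x)) = ent q i s"
          using pq(3) nonstrategic_space_iff i by blast
        then show "ent q i (s(i := x)) - wt i (s(i := x)) * mean i f (s(i := x))
            = ent q i s - wt i s * mean i f s"
          by simp
      qed (use i k_pos zero_sum in auto)
      then show "(\<Sum>s\<in>S. f s * (wt i s * ent v i s))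
        + (\<Sum>s\<in>S. (ent q i s - wt i s * mean i f s) * ent v i s)
        = (\<Sum>s\<in>S. f s * (wt i s * ent v i s))" by simp
    qed
    also have "\<dots> = (\<Sum>s\<in>S. f s * (\<Sum>i\<in>players n. wt i s * ent v i s))"
      by (subst sum.swap) (simp add: sum_distrib_left)
    also have "\<dots> = 0" using balanced by simp
    finally have "u \<bullet> v = 0" .
    then show "v \<bullet> u = 0" using c v pq(1) by (subst comm_scalar_prod[of _ "n * K"]) auto
  qed
  then show ?thesis using v unfolding pure_harmonic_space_def vec_module.orthogonal_complement_def by simp
qed

end

section \<open>The vectors of the harmonic basis\<close>

context weighted_profiles
begin

text \<open>The coordinate at \<open>t p\<close> of the first unit vector minus the
  \<open>s p\<close>-th one. Throughout, \<open>s\<close> indexes a column and \<open>t\<close> is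
  the profile at which it is evaluated.\<close>

abbreviation "dif s p t \<equiv> of_bool (t p = 1) - (of_bool (t p = s p) :: real)"

text \<open>The numerator of the \<open>q\<close>-th block, \<open>q \<le> r\<close>, of a column of \<open>J\<^sub>r\<close> is a difference
  of consecutive terms of this family, which is why the weighted blocks telescope.\<close>

definition tel :: "nat \<Rightarrow> (nat \<Rightarrow> nat) \<Rightarrow> nat \<Rightarrow> (nat \<Rightarrow> nat) \<Rightarrow> real" where
  "tel r s q t = of_bool ((\<forall>p\<in>{1..<q}. t p = s p) \<and> (\<forall>p\<in>{q..r}. t p = 1))"

text \<open>The factor of the players after \<open>r + 1\<close>, common to all nonzero blocks of a
  column.\<close>

definition tail :: "nat \<Rightarrow> (nat \<Rightarrow> nat) \<Rightarrow> (nat \<Rightarrow> nat) \<Rightarrow> real" where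
  "tail r s t = of_bool (\<forall>p\<in>{Suc r<..n}. t p = s p)"

lemma in_players: "p \<in> players n \<longleftrightarrow> 1 \<le> p \<and> p \<le> n"
  by (auto simp: players_def)

lemma strategy_range: "s \<in> S \<Longrightarrow> p \<in> players n \<Longrightarrow> s p \<in> {1..k p}"
  by (auto simp: profiles_def)

lemma index_delta_diff:
  assumes "s \<in> S" "t \<in> S" "p \<in> players n"
  shows "(delta (k p) 1 - delta (k p) (s p)) $ (t p - 1) = dif s p t"
  using strategy_range[OF assms(1,3)] strategy_range[OF assms(2,3)]
  using index_delta[of "t p" "k p" 1] index_delta[of "t p" "k p" "s p"] by auto

lemma prod_list_players_deltas:
  assumes "t \<in> S" "set ps \<subseteq> players n" "\<And>p. p \<in> set ps \<Longrightarrow> g p \<in> {1..k p}"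
    and "\<And>p. p \<in> set ps \<Longrightarrow> u p = delta (k p) (g p)"
  shows "(\<Prod>p\<leftarrow>ps. u p $ (t p - 1)) = of_bool (\<forall>p\<in>set ps. t p = g p)"
proof -
  have "map (\<lambda>p. u p $ (t p - 1)) ps = map (\<lambda>p. delta (k p) (g p) $ (t p - 1)) ps"
    using assms(4) by simp
  then show ?thesis using prod_list_deltas[OF assms(1-3)] by (simp only:)
qed

text \<open>In the blocks \<open>q \<le> r\<close> every Kronecker factor belongs to one player, so
  the coordinate at \<open>t\<close> is a product over players, cut into five segments.\<close>

lemma J_block_low:
  assumes r: "r \<in> {1..<n}" and s: "s \<in> S" and t: "t \<in> S" and q: "q \<in> {1..r}"
  defines "L \<equiv> map (\<lambda>p. delta (k p) (s p)) [1..<q]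
           @ [delta (k q) 1 - delta (k q) (s q)]
           @ map (\<lambda>p. delta (k p) 1) [Suc q..<Suc r]
           @ [delta (k (Suc r)) 1 - delta (k (Suc r)) (s (Suc r))]
           @ map (\<lambda>p. delta (k p) (s p)) [Suc (Suc r)..<Suc n]"
  shows "kron_vecs L \<in> carrier_vec K"
    and "kron_vecs L $ ix t = (tel r s q t - tel r s (Suc q) t) * dif s (Suc r) t * tail r s t"
    and "tel r s q t - tel r s (Suc q) t
      = of_bool ((\<forall>p\<in>{1..<q}. t p = s p) \<and> (\<forall>p\<in>{q<..r}. t p = 1)) * dif s q t"
proof -
  \<comment> \<open>One family indexed by players replaces the five-part list; the two difference
    factors sit at \<open>q\<close> and \<open>r + 1\<close>.\<close>
  define u where "u p = (if p = q \<or> p = Suc r then delta (k p) 1 - delta (k p) (s p)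
    else if q < p \<and> p \<le> r then delta (k p) 1 else delta (k p) (s p))" for p
  have ps: "[1..<Suc n] = [1..<q] @ [q] @ [Suc q..<Suc r] @ [Suc r] @ [Suc (Suc r)..<Suc n]"
    using upt_split_player[of q n] upt_split_player[of q r] upt_split_player[of "Suc r" n] r q
    by (simp add: players_def del: upt_Suc)
  have L: "L = map u [1..<Suc n]"
    unfolding L_def ps using q by (simp add: u_def del: upt_Suc)
  have du: "dim_vec (u p) = k p" for p by (simp add: u_def)
  show "kron_vecs L \<in> carrier_vec K"
    by (rule carrier_vecI) (simp only: L dim_kron_vecs map_map o_def du prod_list_players)
  have sets: "{Suc q..<Suc r} = {q<..r}" "{Suc (Suc r)..<Suc n} = {Suc r<..n}" by auto
  have low: "(\<Prod>p\<leftarrow>[1..<q]. u p $ (t p - 1)) = of_bool (\<forall>p\<in>{1..<q}. t p = s p)"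
    unfolding set_upt[symmetric] by (rule prod_list_players_deltas[OF t])
      (use r q strategy_range[OF s] in \<open>auto simp: u_def players_def\<close>)
  have mid: "(\<Prod>p\<leftarrow>[Suc q..<Suc r]. u p $ (t p - 1)) = of_bool (\<forall>p\<in>{q<..r}. t p = 1)"
    unfolding sets[symmetric] set_upt[symmetric] by (rule prod_list_players_deltas[OF t])
      (use r q k_pos in \<open>auto simp: u_def players_def Suc_le_eq\<close>)
  have "u p = delta (k p) (s p)" if "Suc (Suc r) \<le> p" for p
    using that q by (simp add: u_def)
  then have high: "(\<Prod>p\<leftarrow>[Suc (Suc r)..<Suc n]. u p $ (t p - 1)) = tail r s t"
    unfolding tail_def sets[symmetric] set_upt[symmetric]
    by (intro prod_list_players_deltas[OF t] strategy_range[OF s]) (auto simp: players_def)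
  have pts: "u q $ (t q - 1) = dif s q t" "u (Suc r) $ (t (Suc r) - 1) = dif s (Suc r) t"
    using index_delta_diff[OF s t] r q by (simp_all add: u_def players_def)
  \<comment> \<open>The conditions in \<open>tel\<close> at \<open>q\<close> and at
    \<open>q + 1\<close> agree except for player \<open>q\<close>, who plays 1 in the former and
    \<open>s q\<close> in the latter; hence their difference factors.\<close>
  have "{q..r} = insert q {q<..r}" "{1..<Suc q} = insert q {1..<q}" "{Suc q..r} = {q<..r}"
    using q by auto
  then show *: "tel r s q t - tel r s (Suc q) t
      = of_bool ((\<forall>p\<in>{1..<q}. t p = s p) \<and> (\<forall>p\<in>{q<..r}. t p = 1)) * dif s q t"
    by (auto simp: tel_def)
  have "kron_vecs L $ ix t = (\<Prod>p\<leftarrow>[1..<Suc n]. u p $ (t p - 1))"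
    unfolding L profile_index_def
    by (rule index_kron_vecs[OF t _ du]) (simp only: set_players_list order_refl)
  also have "\<dots> = of_bool (\<forall>p\<in>{1..<q}. t p = s p) * (dif s q t *
      (of_bool (\<forall>p\<in>{q<..r}. t p = 1) * (dif s (Suc r) t * tail r s t)))"
    unfolding ps map_append prod_list.append list.map prod_list.Cons prod_list.Nil low mid high pts
    by simp
  finally show "kron_vecs L $ ix t = (tel r s q t - tel r s (Suc q) t) * dif s (Suc r) t * tail r s t"
    unfolding * by simp
qed

text \<open>The leading factor is a difference of two Kronecker products rather than a product over
  players, so the index is cut after player \<open>r\<close> and the halves form one Kronecker pair.
  That difference equals the telescoped sum of the consecutive differences in the lower
  blocks.\<close>

lemma J_block_top:
  assumes r: "r \<in> {1..<n}" and s: "s \<in> S" and t: "t \<in> S"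
  defines "L \<equiv> [kron_vecs (map (\<lambda>p. delta (k p) 1) [1..<Suc r])
              - kron_vecs (map (\<lambda>p. delta (k p) (s p)) [1..<Suc r])]
           @ [delta (k (Suc r)) 1 - delta (k (Suc r)) (s (Suc r))]
           @ map (\<lambda>p. delta (k p) (s p)) [Suc (Suc r)..<Suc n]"
  shows "kron_vecs L \<in> carrier_vec K"
    and "kron_vecs L $ ix t = (tel r s 1 t - tel r s (Suc r) t) * dif s (Suc r) t * tail r s t"
proof -
  define u where "u p = (if p = Suc r then delta (k p) 1 - delta (k p) (s p) else delta (k p) (s p))" for p
  let ?lo = "[1..<Suc r]" and ?hi = "[Suc r..<Suc n]"
  define D where "D = kron_vecs (map (\<lambda>p. delta (k p) 1) ?lo) - kron_vecs (map (\<lambda>p. delta (k p) (s p)) ?lo)"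
  have hi: "?hi = Suc r # [Suc (Suc r)..<Suc n]" using r by (simp add: upt_conv_Cons del: upt_Suc)
  have ps: "[1..<Suc n] = ?lo @ ?hi"
    using upt_add_eq_append[of 1 "Suc r" "n - r"] r by (simp del: upt_Suc)
  have L: "kron_vecs L = kron_vec D (kron_vecs (map u ?hi))"
  proof -
    have "map u [Suc (Suc r)..<Suc n] = map (\<lambda>p. delta (k p) (s p)) [Suc (Suc r)..<Suc n]"
      by (rule map_cong[OF refl]) (auto simp: u_def)
    then have "kron_vecs (map u ?hi)
        = kron_vec (u (Suc r)) (kron_vecs (map (\<lambda>p. delta (k p) (s p)) [Suc (Suc r)..<Suc n]))"
      unfolding hi list.map kron_vecs_Cons by (simp only:)
    then show ?thesis
      unfolding L_def D_def append_Cons append_Nil kron_vecs_Cons by (simp add: u_def del: upt_Suc)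
  qed
  have du: "dim_vec (u p) = k p" for p by (simp add: u_def)
  have dD: "dim_vec D = prod_list (map k ?lo)" by (simp add: D_def o_def del: upt_Suc)
  have dh: "dim_vec (kron_vecs (map u ?hi)) = prod_list (map k ?hi)"
    by (simp only: dim_kron_vecs map_map o_def du)
  show "kron_vecs L \<in> carrier_vec K"
    by (rule carrier_vecI)
      (simp only: L dim_kron_vec dD dh prod_list_players[symmetric] ps map_append prod_list.append)
  have sub: "set ?lo \<subseteq> players n" "set ?hi \<subseteq> players n" using r by (auto simp: players_def)
  have "D $ mixed_radix k ?lo t = of_bool (\<forall>p\<in>set ?lo. t p = 1) - of_bool (\<forall>p\<in>set ?lo. t p = s p)"
    unfolding D_def
    using index_kron_deltas[OF t sub(1), of "\<lambda>_. 1"] index_kron_deltas[OF t sub(1), of s]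
      mixed_radix_less[OF t sub(1)] sub(1) strategy_range[OF s] k_pos
    by (simp add: o_def Suc_le_eq subset_iff del: upt_Suc set_upt)
  also have "\<dots> = tel r s 1 t - tel r s (Suc r) t"
    by (simp add: tel_def atLeastLessThanSuc_atLeastAtMost del: upt_Suc)
  finally have D: "D $ mixed_radix k ?lo t = tel r s 1 t - tel r s (Suc r) t" .
  have "kron_vecs (map u ?hi) $ mixed_radix k ?hi t = (\<Prod>p\<leftarrow>?hi. u p $ (t p - 1))"
    by (rule index_kron_vecs[OF t sub(2) du])
  also have "\<dots> = dif s (Suc r) t * (\<Prod>p\<leftarrow>[Suc (Suc r)..<Suc n]. u p $ (t p - 1))"
    using index_delta_diff[OF s t, of "Suc r"] r
    unfolding hi by (simp add: u_def players_def del: upt_Suc)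
  also have "(\<Prod>p\<leftarrow>[Suc (Suc r)..<Suc n]. u p $ (t p - 1)) = tail r s t"
  proof -
    have sets: "{Suc (Suc r)..<Suc n} = {Suc r<..n}" by auto
    show ?thesis
      unfolding tail_def sets[symmetric] set_upt[symmetric] by (rule prod_list_players_deltas[OF t])
        (use r strategy_range[OF s] in \<open>auto simp: u_def players_def\<close>)
  qed
  finally have H: "kron_vecs (map u ?hi) $ mixed_radix k ?hi t = dif s (Suc r) t * tail r s t" .
  have "kron_vecs L $ ix t = D $ mixed_radix k ?lo t * kron_vecs (map u ?hi) $ mixed_radix k ?hi t"
    unfolding L profile_index_def ps mixed_radix_append dh[symmetric]
    by (rule index_kron_vec) (simp_all only: dD dh mixed_radix_less[OF t] sub)
  then show "kron_vecs L $ ix t = (tel r s 1 t - tel r s (Suc r) t) * dif s (Suc r) t * tail r s t"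
    unfolding D H by simp
qed

lemma J_vec_entry:
  assumes r: "r \<in> {1..<n}" and s: "s \<in> S"
  shows "J_vec n k w r s \<in> carrier_vec (n * K)"
    and "i \<in> players n \<Longrightarrow> t \<in> S \<Longrightarrow> ent (J_vec n k w r s) i t =
      (if i \<le> r then (tel r s i t - tel r s (Suc i) t) * dif s (Suc r) t * tail r s t
       else if i = Suc r then - ((tel r s 1 t - tel r s (Suc r) t) * dif s (Suc r) t * tail r s t)
       else 0) / wt i t"
proof -
  \<comment> \<open>Names the block function of \<open>J_vec\<close>, so that blocks can be read
    through \<open>entry_stack\<close>.\<close>
  define F where "F q = (if q \<le> r then
       mat_inv (Lambda_mat n k w q) *\<^sub>v
         kron_vecs (
           map (\<lambda>p. delta (k p) (s p)) [1..<q]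
           @ [delta (k q) 1 - delta (k q) (s q)]
           @ map (\<lambda>p. delta (k p) 1) [Suc q..<Suc r]
           @ [delta (k (Suc r)) 1 - delta (k (Suc r)) (s (Suc r))]
           @ map (\<lambda>p. delta (k p) (s p)) [Suc (Suc r)..<Suc n])
     else if q = Suc r then
       - (mat_inv (Lambda_mat n k w q) *\<^sub>v
         kron_vecs (
           [kron_vecs (map (\<lambda>p. delta (k p) 1) [1..<Suc r])
              - kron_vecs (map (\<lambda>p. delta (k p) (s p)) [1..<Suc r])]
           @ [delta (k (Suc r)) 1 - delta (k (Suc r)) (s (Suc r))]
           @ map (\<lambda>p. delta (k p) (s p)) [Suc (Suc r)..<Suc n]))
     else 0\<^sub>v (profile_count n k))" for q
  have J: "J_vec n k w r s = stack_vecs (map F [1..<Suc n])"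
    unfolding J_vec_def F_def ..
  have Fc: "F q \<in> carrier_vec K" if q: "q \<in> players n" for q
    unfolding F_def
    using mult_mat_vec_carrier[OF Lambda_inv_carrier[OF q] J_block_low(1)[OF r s s, of q]]
      mult_mat_vec_carrier[OF Lambda_inv_carrier[OF q] J_block_top(1)[OF r s s]] q
    by (auto simp: in_players simp del: upt_Suc)
  show "J_vec n k w r s \<in> carrier_vec (n * K)"
    unfolding J by (rule stack_players_carrier[OF Fc])
  assume i: "i \<in> players n" and t: "t \<in> S"
  have *: "ent (J_vec n k w r s) i t = F i $ ix t"
    unfolding J by (rule entry_stack[OF Fc i t])
  show "ent (J_vec n k w r s) i t =
      (if i \<le> r then (tel r s i t - tel r s (Suc i) t) * dif s (Suc r) t * tail r s t
       else if i = Suc r then - ((tel r s 1 t - tel r s (Suc r) t) * dif s (Suc r) t * tail r s t)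
       else 0) / wt i t"
  proof (cases "i \<le> r")
    case True
    then have i': "i \<in> {1..r}" using i by (simp add: in_players)
    show ?thesis
      unfolding * F_def if_P[OF True]
        Lambda_inv_mult[OF i t J_block_low(1)[OF r s t i']] J_block_low(2)[OF r s t i'] ..
  next
    case False
    show ?thesis
    proof (cases "i = Suc r")
      case True
      have "dim_vec (mat_inv (\<Lambda> i) *\<^sub>v v) = K" for v
        using Lambda_inv_carrier[OF i] by simp
      then have neg: "(- (mat_inv (\<Lambda> i) *\<^sub>v v)) $ ix t = - ((mat_inv (\<Lambda> i) *\<^sub>v v) $ ix t)" for v
        using profile_index_less[OF t] by simp
      show ?thesis
        unfolding * F_def if_not_P[OF False] if_P[OF True] neg
          Lambda_inv_mult[OF i t J_block_top(1)[OF r s t]] J_block_top(2)[OF r s t]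
        by (rule minus_divide_left)
    next
      case False
      then show ?thesis using \<open>\<not> i \<le> r\<close> profile_index_less[OF t] by (simp add: * F_def)
    qed
  qed
qed

text \<open>Each of the two indicators counts exactly one strategy; for \<open>s i = 1\<close> they
  coincide.\<close>

lemma sum_dif:
  assumes "i \<in> players n" "s \<in> S"
  shows "(\<Sum>y\<in>{1..k i}. dif s i (t(i := y))) = 0"
  using strategy_range[OF assms(2,1)] k_pos[OF assms(1)]
  by (simp add: sum_subtractf of_bool_def sum.delta)

lemma J_vec_harmonic:
  assumes r: "r \<in> {1..<n}" and s: "s \<in> S"
  shows "J_vec n k w r s \<in> HH"
proof (rule pure_harmonicI[OF J_vec_entry(1)[OF r s]])
  fix i t assume i: "i \<in> players n" and t: "t \<in> S"
  have t': "t(i := y) \<in> S" if "y \<in> {1..k i}" for y by (rule players_upd[OF i t that])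
  \<comment> \<open>Along own deviations of player \<open>i\<close> every entry is a fixed multiple
    of \<open>dif s i\<close>, whichever block is considered; beyond block \<open>r + 1\<close> the
    multiple is 0.\<close>
  obtain c where c: "\<And>y. y \<in> {1..k i} \<Longrightarrow> ent (J_vec n k w r s) i (t(i := y)) = c * dif s i (t(i := y))"
  proof (cases "i \<le> r")
    case True
    then have i': "i \<in> {1..r}" using i by (simp add: in_players)
    \<comment> \<open>The factored form of the difference of \<open>tel\<close> values isolates
      player \<open>i\<close>: all remaining conditions concern other players.\<close>
    have "ent (J_vec n k w r s) i (t(i := y)) = (of_bool ((\<forall>p\<in>{1..<i}. t p = s p) \<and> (\<forall>p\<in>{i<..r}. t p = 1))
        * dif s (Suc r) t * tail r s t / wt i t) * dif s i (t(i := y))" if y: "y \<in> {1..k i}" for y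
    proof -
      have "tail r s (t(i := y)) = tail r s t" "dif s (Suc r) (t(i := y)) = dif s (Suc r) t"
        using True by (simp_all add: tail_def)
      moreover have "((\<forall>p\<in>{1..<i}. (t(i := y)) p = s p) \<and> (\<forall>p\<in>{i<..r}. (t(i := y)) p = 1))
        \<longleftrightarrow> ((\<forall>p\<in>{1..<i}. t p = s p) \<and> (\<forall>p\<in>{i<..r}. t p = 1))" by simp
      moreover have alg: "a * d * b * c / x = a * b * c / x * d" for a b c d x :: real by simp
      ultimately show ?thesis
        unfolding J_vec_entry(2)[OF r s i t'[OF y]] if_P[OF True] J_block_low(3)[OF r s t'[OF y] i']
          restrict_upd_others by (simp only: alg)
    qed
    then show ?thesis by (rule that)
  next
    case False
    show ?thesis
    proof (cases "i = Suc r")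
      case True
      have "ent (J_vec n k w r s) i (t(i := y)) = (- ((tel r s 1 t - tel r s (Suc r) t) * tail r s t / wt i t))
        * dif s i (t(i := y))" if y: "y \<in> {1..k i}" for y
      proof -
        have "tail r s (t(i := y)) = tail r s t" "tel r s 1 (t(i := y)) = tel r s 1 t"
          "tel r s (Suc r) (t(i := y)) = tel r s (Suc r) t"
          using True by (simp_all add: tail_def tel_def)
        then show ?thesis
          unfolding J_vec_entry(2)[OF r s i t'[OF y]] restrict_upd_others
          using True by (simp add: mult.assoc mult.commute mult.left_commute)
      qed
      then show ?thesis by (rule that)
    next
      case False
      then show ?thesis using \<open>\<not> i \<le> r\<close> J_vec_entry(2)[OF r s i t'] by (intro that[of 0]) simp
    qed
  qed
  then show "(\<Sum>y\<in>{1..k i}. ent (J_vec n k w r s) i (t(i := y))) = 0"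
    using sum_dif[OF i s, of t] by (simp add: sum_distrib_left[symmetric])
next
  fix t assume t: "t \<in> S"
  let ?A = "dif s (Suc r) t * tail r s t"
  have players_split: "players n = {1..r} \<union> ({Suc r} \<union> {Suc r<..n})" using r by (auto simp: players_def)
  \<comment> \<open>The weights cancel the inverse of \<open>Lambda_mat\<close>, leaving consecutive
    differences against the single opposite term of block \<open>r + 1\<close>.\<close>
  have "(\<Sum>i\<in>players n. wt i t * ent (J_vec n k w r s) i t) =
    (\<Sum>i\<in>players n. if i \<le> r then (tel r s i t - tel r s (Suc i) t) * ?A
       else if i = Suc r then - ((tel r s 1 t - tel r s (Suc r) t) * ?A) else 0)"
  proof (rule sum.cong[OF refl])
    fix i assume i: "i \<in> players n"
    show "wt i t * ent (J_vec n k w r s) i t = (if i \<le> r then (tel r s i t - tel r s (Suc i) t) * ?A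
       else if i = Suc r then - ((tel r s 1 t - tel r s (Suc r) t) * ?A) else 0)"
      unfolding J_vec_entry(2)[OF r s i t] using wt_pos[OF i t] by (simp add: mult.assoc)
  qed
  also have "(\<Sum>i\<in>players n. if i \<le> r then (tel r s i t - tel r s (Suc i) t) * ?A
       else if i = Suc r then - ((tel r s 1 t - tel r s (Suc r) t) * ?A) else 0)
     = (\<Sum>i\<in>{1..r}. (tel r s i t - tel r s (Suc i) t) * ?A) - (tel r s 1 t - tel r s (Suc r) t) * ?A"
    unfolding players_split by (subst sum.union_disjoint; (subst sum.union_disjoint)?) auto
  also have "(\<Sum>i\<in>{1..r}. (tel r s i t - tel r s (Suc i) t) * ?A) = (tel r s 1 t - tel r s (Suc r) t) * ?A"
  proof -
    have "(\<Sum>i\<in>{1..m}. tel r s i t - tel r s (Suc i) t) = tel r s 1 t - tel r s (Suc m) t" for m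
      by (induction m) auto
    then show ?thesis by (simp only: sum_distrib_right[symmetric])
  qed
  finally show "(\<Sum>i\<in>players n. wt i t * ent (J_vec n k w r s) i t) = 0" by (simp only: diff_self)
qed

text \<open>Blocks beyond \<open>r' + 1\<close> of a column are zero, which settles
  \<open>r' < r\<close>. For \<open>r' = r\<close> the two exclusions in \<open>J_index\<close> act
  separately: some player up to \<open>r\<close> does not play 1 in \<open>s\<close>, so the first
  \<open>tel\<close> term vanishes, and \<open>s (Suc r) \<noteq> 1\<close> leaves only the negative
  indicator of \<open>dif\<close>.\<close>

lemma J_vec_triangular:
  assumes r: "r \<in> {1..<n}" and s: "s \<in> J_index n k r" and r': "r' \<in> {1..<n}" "r' \<le> r"
    and s': "s' \<in> J_index n k r'"
  shows "ent (J_vec n k w r' s') (Suc r) s = (if r' = r \<and> s' = s then - 1 / wt (Suc r) s else 0)"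
proof -
  have S: "s \<in> S" "s' \<in> S" using s s' by (auto simp: J_index_def)
  have i: "Suc r \<in> players n" using r by (simp add: in_players)
  show ?thesis
  proof (cases "r' = r")
    case False
    then show ?thesis using J_vec_entry(2)[OF r'(1) S(2) i S(1)] r' by simp
  next
    case True
    have 1: "tel r s' 1 s = 0" using s by (auto simp: tel_def J_index_def)
    have "players n = {1..<Suc r} \<union> {Suc r} \<union> {Suc r<..n}" using r by (auto simp: players_def)
    then have "s' = s" if "\<forall>p\<in>{1..<Suc r}. s p = s' p" "s (Suc r) = s' (Suc r)" "\<forall>p\<in>{Suc r<..n}. s p = s' p"
      using that by (intro profiles_eqI[OF S(2,1)]) auto
    then have "(s' = s) = ((\<forall>p\<in>{1..<Suc r}. s p = s' p) \<and> s (Suc r) = s' (Suc r) \<and> (\<forall>p\<in>{Suc r<..n}. s p = s' p))"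
      by blast
    moreover have "s (Suc r) \<noteq> 1" using s by (simp add: J_index_def)
    ultimately have "tel r s' (Suc r) s * dif s' (Suc r) s * tail r s' s = - of_bool (s' = s)"
      by (auto simp: tel_def tail_def)
    then show ?thesis
      using J_vec_entry(2)[OF r'(1) S(2) i S(1)] True 1 by simp
  qed
qed

text \<open>Profiles avoiding strategy 1 at player \<open>r + 1\<close> are counted, minus those in
  which all players up to \<open>r\<close> also play 1. Integers avoid truncated subtraction, and
  the last two terms telescope in \<open>r\<close>.\<close>

lemma card_J_index:
  assumes r: "r \<in> {1..<n}"
  shows "int (card (J_index n k r)) = int K - int (prod k (others n (Suc r)))
    - int (\<Prod>p\<in>{r<..n}. k p) + int (\<Prod>p\<in>{Suc r<..n}. k p)"
proof -
  \<comment> \<open>Both sets are products of ranges, so their cardinalities are products; excluding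
    strategy 1 shrinks a factor to \<open>k p - 1\<close>.\<close>
  define A where "A = (\<Pi>\<^sub>E p\<in>players n. if p = Suc r then {2..k p} else {1..k p})"
  define B where "B = (\<Pi>\<^sub>E p\<in>players n. if p = Suc r then {2..k p} else if p \<le> r then {1} else {1..k p})"
  have i: "Suc r \<in> players n" using r by (simp add: in_players)
  have kr: "k (Suc r) \<ge> 1" using k_pos[OF i] by simp
  have J: "J_index n k r = A - B"
  proof (intro equalityI subsetI)
    fix s assume s: "s \<in> J_index n k r"
    then have "s \<in> A" by (force simp: J_index_def A_def profiles_def PiE_iff)
    moreover have "s \<notin> B" using s r by (force simp: J_index_def B_def PiE_iff in_players)
    ultimately show "s \<in> A - B" by simp
  next
    fix s assume s: "s \<in> A - B"
    have p: "s \<in> S" using s by (fastforce simp: A_def profiles_def PiE_iff split: if_splits)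
    have ne: "s (Suc r) \<noteq> 1" using s i by (force simp: A_def PiE_iff)
    have "\<not> (\<forall>p\<in>{1..r}. s p = 1)"
    proof
      assume "\<forall>p\<in>{1..r}. s p = 1"
      then have "s \<in> B" using s r by (auto simp: A_def B_def PiE_iff in_players split: if_splits)
      then show False using s by simp
    qed
    then show "s \<in> J_index n k r" using p ne by (simp add: J_index_def)
  qed
  have sub: "B \<subseteq> A" unfolding A_def B_def
    using k_pos by (intro PiE_mono) (auto simp: Suc_le_eq)
  have finB: "finite B" unfolding B_def by (intro finite_PiE) auto
  have "card A = (\<Prod>p\<in>players n. if p = Suc r then k p - 1 else k p)"
    unfolding A_def by (subst card_PiE) (auto intro!: prod.cong)
  also have "\<dots> = (k (Suc r) - 1) * (\<Prod>p\<in>others n (Suc r). if p = Suc r then k p - 1 else k p)"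
    using i by (simp add: others_def prod.remove)
  also have "(\<Prod>p\<in>others n (Suc r). if p = Suc r then k p - 1 else k p) = prod k (others n (Suc r))"
    by (rule prod.cong) (auto simp: others_def)
  finally have cA: "int (card A) = int K - int (prod k (others n (Suc r)))"
    using kr by (simp add: profile_count_others[OF i] of_nat_diff algebra_simps)
  have "card B = (\<Prod>p\<in>players n. if p = Suc r then k p - 1 else if p \<le> r then 1 else k p)"
    unfolding B_def by (subst card_PiE) (auto intro!: prod.cong)
  also have "\<dots> = (\<Prod>p\<in>{r<..n}. if p = Suc r then k p - 1 else if p \<le> r then 1 else k p)"
    by (rule prod.mono_neutral_right) (use r in \<open>auto simp: in_players\<close>)
  also have "{r<..n} = insert (Suc r) {Suc r<..n}" using r by auto
  also have "(\<Prod>p\<in>insert (Suc r) {Suc r<..n}. if p = Suc r then k p - 1 else if p \<le> r then 1 else k p)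
    = (k (Suc r) - 1) * (\<Prod>p\<in>{Suc r<..n}. k p)"
    by (subst prod.insert) (auto intro!: prod.cong)
  finally have cB: "int (card B) = int (\<Prod>p\<in>{r<..n}. k p) - int (\<Prod>p\<in>{Suc r<..n}. k p)"
  proof -
    assume "card B = (k (Suc r) - 1) * (\<Prod>p\<in>{Suc r<..n}. k p)"
    moreover have "(\<Prod>p\<in>{r<..n}. k p) = k (Suc r) * (\<Prod>p\<in>{Suc r<..n}. k p)"
    proof -
      have "{r<..n} = insert (Suc r) {Suc r<..n}" using r by auto
      then show ?thesis by simp
    qed
    ultimately show ?thesis using kr by (simp add: of_nat_diff algebra_simps del: of_nat_prod)
  qed
  have "card (J_index n k r) = card A - card B" unfolding J by (rule card_Diff_subset[OF finB sub])
  moreover have "card B \<le> card A" unfolding A_def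
    by (rule card_mono) (use sub in \<open>auto simp: A_def intro!: finite_PiE\<close>)
  ultimately show ?thesis using cA cB by simp
qed

text \<open>Each summand is at most half of \<open>K\<close> because every player has two
  strategies, and n/2 \<le> n - 1 for n \<ge> 2. This keeps the subtraction in \<open>dim_H\<close>
  from truncating.\<close>

lemma dim_N_le: "dim_N n k \<le> (n - 1) * K"
proof -
  have "2 * dim_N n k = (\<Sum>i\<in>players n. 2 * prod k (others n i))"
    unfolding dim_N_eq_sum by (rule sum_distrib_left)
  also have "\<dots> \<le> (\<Sum>i\<in>players n. K)"
    by (rule sum_mono) (simp add: profile_count_others two_strategies)
  also have "\<dots> = n * K" by (simp add: players_def)
  also have "\<dots> \<le> (2 * (n - 1)) * K" using two_players by (intro mult_le_mono1) simp
  finally show ?thesis by simp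
qed

lemma dims_add: "dim_P n k + (dim_N n k + dim_H n k) = n * K"
proof -
  have "dim_N n k + dim_H n k = (n - 1) * K + 1"
    using dim_N_le unfolding dim_H_def dim_N_def by simp
  moreover have "n * K = K + (n - 1) * K" using two_players by (cases n) auto
  ultimately show ?thesis using K_pos by (simp add: dim_P_def)
qed

text \<open>The sum over \<open>r\<close> misses the coset count of player 1. The telescoping sum
  supplies exactly that term, since the players after 1 are the opponents of player 1; its other end
  is an empty product and yields the \<open>+ 1\<close> in \<open>dim_H\<close>.\<close>

lemma sum_card_J_index: "(\<Sum>r\<in>{1..<n}. card (J_index n k r)) = dim_H n k"
proof -
  let ?N = "\<lambda>i. prod k (others n i)" and ?G = "\<lambda>r. \<Prod>p\<in>{r<..n}. k p"
  have tel: "(\<Sum>r\<in>{1..<n}. int (?G (Suc r)) - int (?G r)) = int (?G n) - int (?G 1)"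
    using two_players by (intro sum_Suc_diff') simp
  have "others n 1 = {1<..n}" by (auto simp: others_def players_def)
  then have G: "?G 1 = ?N 1" "?G n = 1" by simp_all
  have shift: "(\<Sum>r\<in>{1..<n}. int (?N (Suc r))) = (\<Sum>i\<in>players n. int (?N i)) - int (?N 1)"
  proof -
    have "(\<Sum>r\<in>{1..<n}. int (?N (Suc r))) = (\<Sum>i\<in>{Suc 1..<Suc n}. int (?N i))"
      by (rule sum.shift_bounds_Suc_ivl[symmetric])
    moreover have "players n = insert 1 {Suc 1..<Suc n}" using two_players by (auto simp: players_def)
    ultimately show ?thesis by simp
  qed
  note N = dim_N_eq_sum and le = dim_N_le
  have "int (\<Sum>r\<in>{1..<n}. card (J_index n k r))
      = (\<Sum>r\<in>{1..<n}. int K - int (?N (Suc r)) + (int (?G (Suc r)) - int (?G r)))"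
    unfolding of_nat_sum
  proof (rule sum.cong[OF refl])
    fix r assume "r \<in> {1..<n}"
    from card_J_index[OF this] show "int (card (J_index n k r))
        = int K - int (?N (Suc r)) + (int (?G (Suc r)) - int (?G r))" by linarith
  qed
  also have "\<dots> = int ((n - 1) * K) - int (dim_N n k) + 1"
    unfolding sum.distrib tel unfolding sum_subtractf shift G N by simp
  also have "\<dots> = int (dim_H n k)"
    using le unfolding dim_H_def dim_N_def[symmetric] by (simp add: of_nat_diff)
  finally show ?thesis by (simp only: of_nat_eq_iff)
qed

end

section \<open>The basis matrix and the projections\<close>

lemma mat_of_cols_append_mult:
  fixes us vs :: "real vec list"
  assumes "x \<in> carrier_vec (length us)" "y \<in> carrier_vec (length vs)"
  shows "mat_of_cols m (us @ vs) *\<^sub>v (x @\<^sub>v y) = mat_of_cols m us *\<^sub>v x + mat_of_cols m vs *\<^sub>v y"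
proof (rule eq_vecI)
  fix a assume "a < dim_vec (mat_of_cols m us *\<^sub>v x + mat_of_cols m vs *\<^sub>v y)"
  then have a: "a < m" by simp
  have "row (mat_of_cols m (us @ vs)) a = row (mat_of_cols m us) a @\<^sub>v row (mat_of_cols m vs) a"
    using a by (intro eq_vecI) (auto simp: mat_of_cols_index nth_append)
  then show "(mat_of_cols m (us @ vs) *\<^sub>v (x @\<^sub>v y)) $ a = (mat_of_cols m us *\<^sub>v x + mat_of_cols m vs *\<^sub>v y) $ a"
    using a scalar_prod_append[of "row (mat_of_cols m us) a" "length us" "row (mat_of_cols m vs) a" "length vs" x y]
      assms by (simp add: row_carrier_vec[of _ m])
qed simp

lemma mat_of_cols_cols_carrier: "A \<in> carrier_mat m c \<Longrightarrow> mat_of_cols m (cols A) = A"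
  using mat_of_cols_cols[of A] by auto

lemma scalar_prod_self_eq_0:
  fixes v :: "real vec"
  assumes "v \<in> carrier_vec m" "v \<bullet> v = 0"
  shows "v = 0\<^sub>v m"
proof (rule eq_vecI)
  fix a assume "a < dim_vec (0\<^sub>v m :: real vec)"
  then have a: "a < m" by simp
  have "(\<Sum>i\<in>{0..<m}. v $ i * v $ i) = 0"
    using assms by (simp add: scalar_prod_def)
  then have "v $ a * v $ a = 0"
    using a by (subst (asm) sum_nonneg_eq_0_iff) auto
  then show "v $ a = 0\<^sub>v m $ a" using a by simp
qed (use assms in simp)

text \<open>For uniqueness, the difference of two candidates is orthogonal to all of
  \<open>U\<close>, in particular to both candidates, hence to itself.\<close>

lemma orth_projI:
  assumes U: "U \<subseteq> carrier_vec m" and p: "p \<in> U" and v: "v \<in> carrier_vec m"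
    and orth: "\<And>u. u \<in> U \<Longrightarrow> (v - p) \<bullet> u = 0"
  shows "orth_proj m U v = p"
  unfolding orth_proj_def
proof (rule the_equality)
  have pc: "p \<in> carrier_vec m" using U p by auto
  show "p \<in> U \<and> v - p \<in> vec_module.orthogonal_complement m U"
    using p v pc orth by (simp add: vec_module.orthogonal_complement_def)
  fix p' assume p': "p' \<in> U \<and> v - p' \<in> vec_module.orthogonal_complement m U"
  then have pc': "p' \<in> carrier_vec m" and orth': "\<And>u. u \<in> U \<Longrightarrow> (v - p') \<bullet> u = 0"
    using U by (auto simp: vec_module.orthogonal_complement_def)
  have "p' - p = (v - p) - (v - p')" using v pc pc' by (intro eq_vecI) auto
  then have z: "(p' - p) \<bullet> u = 0" if "u \<in> U" for u
    using orth[OF that] orth'[OF that] minus_scalar_prod_distrib[of "v - p" m "v - p'" u] v pc pc' U that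
    by auto
  have "(p' - p) \<bullet> (p' - p) = (p' - p) \<bullet> p' - (p' - p) \<bullet> p"
    using pc pc' by (intro scalar_prod_minus_distrib) auto
  also have "\<dots> = 0" using z p p' by simp
  finally have "p' - p = 0\<^sub>v m" using pc pc' by (intro scalar_prod_self_eq_0) auto
  then have "(p' - p) + p = p" using pc by simp
  moreover have "(p' - p) + p = p'" using pc pc' by (intro eq_vecI) auto
  ultimately show "p' = p" by simp
qed

text \<open>A trivial kernel gives a nonzero determinant and thus a unit of the matrix ring, in
  which case \<open>mat_inverse\<close> returns a result.\<close>

lemma invertible_mat_of_inj:
  fixes A :: "real mat"
  assumes A: "A \<in> carrier_mat m m"
    and inj: "\<And>x. x \<in> carrier_vec m \<Longrightarrow> A *\<^sub>v x = 0\<^sub>v m \<Longrightarrow> x = 0\<^sub>v m"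
  shows "invertible_mat A" "mat_inv A \<in> carrier_mat m m" "A * mat_inv A = 1\<^sub>m m"
proof -
  have "det A \<noteq> 0" using inj det_0_iff_vec_prod_zero_field[OF A] by auto
  then have "A \<in> Units (ring_mat TYPE(real) m ())" by (rule det_non_zero_imp_unit[OF A])
  then obtain B where B: "mat_inverse A = Some B"
    using mat_inverse(1)[OF A, where b = "()"] by (cases "mat_inverse A") auto
  from mat_inverse(2)[OF A B] have AB: "A * B = 1\<^sub>m m" "B * A = 1\<^sub>m m" "B \<in> carrier_mat m m" by auto
  then show "mat_inv A \<in> carrier_mat m m" "A * mat_inv A = 1\<^sub>m m"
    by (simp_all add: mat_inv_def B)
  show "invertible_mat A"
    using A AB by (auto simp: invertible_mat_def inverts_mat_def intro!: exI[of _ B])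
qed

lemma stack_zero_vecs: "stack_vecs (map (\<lambda>i. 0\<^sub>v (d i)) is) = 0\<^sub>v (sum_list (map d is))"
  by (induction "is") (auto intro!: eq_vecI)

lemma mult_mat_of_cols_index:
  fixes cs :: "real vec list"
  assumes "x \<in> carrier_vec (length cs)" "a < m"
  shows "(mat_of_cols m cs *\<^sub>v x) $ a = (\<Sum>j<length cs. cs ! j $ a * x $ j)"
  using assms by (simp add: scalar_prod_def mat_of_cols_index lessThan_atLeast0)

context weighted_profiles
begin

lemma invariant_imp_constant:
  assumes inv: "\<And>i s x. i \<in> players n \<Longrightarrow> s \<in> S \<Longrightarrow> x \<in> {1..k i} \<Longrightarrow> f (s(i := x)) = f s"
    and s: "s \<in> S" and t: "t \<in> S"
  shows "f s = f t"
proof -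
  \<comment> \<open>Hybrid profiles: players up to \<open>j\<close> already play as in
    \<open>t\<close>, so consecutive hybrids differ at most at one player.\<close>
  define mix where "mix j = (\<lambda>p. if p \<in> {1..j} then t p else s p)" for j :: nat
  have "mix j \<in> S \<and> f (mix j) = f s" if "j \<le> n" for j
    using that
  proof (induction j)
    case 0
    then show ?case using s by (simp add: mix_def)
  next
    case (Suc j)
    have i: "Suc j \<in> players n" using Suc.prems by (simp add: in_players)
    have "mix (Suc j) = (mix j)(Suc j := t (Suc j))" by (auto simp: mix_def fun_eq_iff le_Suc_eq)
    moreover have "mix j \<in> S" "f (mix j) = f s" using Suc by simp_all
    ultimately show ?case
      using inv[OF i, of "mix j" "t (Suc j)"] players_upd[OF i, of "mix j" k "t (Suc j)"]
        strategy_range[OF t i] by (simp only:)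
  qed
  moreover have "mix n \<in> S \<Longrightarrow> mix n = t"
    by (rule profiles_eqI[OF _ t]) (auto simp: mix_def in_players)
  ultimately show ?thesis by fastforce
qed

lemma B_P0_carrier: "B_P0 n k w \<in> carrier_mat (n * K) (dim_P n k)"
  using B_P_carrier by (auto simp: B_P0_def dim_P_def)

text \<open>Deleting the last column amounts to fixing the last coefficient at 0; this carries the
  description of \<open>B_P\<close> over to \<open>B_P0\<close>.\<close>

lemma B_P0_mult:
  assumes x: "x \<in> carrier_vec (dim_P n k)"
  shows "B_P0 n k w *\<^sub>v x = B_P n k w *\<^sub>v (x @\<^sub>v 0\<^sub>v 1)"
proof -
  let ?C = "cols (B_P n k w)"
  have len: "length ?C = K" using B_P_carrier by auto
  then have ne: "?C \<noteq> []" using K_pos by (metis length_greater_0_conv)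
  then have "B_P n k w = mat_of_cols (n * K) (butlast ?C @ [last ?C])"
    using mat_of_cols_cols_carrier[OF B_P_carrier] by simp
  then have "B_P n k w *\<^sub>v (x @\<^sub>v 0\<^sub>v 1) = B_P0 n k w *\<^sub>v x + mat_of_cols (n * K) [last ?C] *\<^sub>v 0\<^sub>v 1"
    using mat_of_cols_append_mult[of x "butlast ?C" "0\<^sub>v 1" "[last ?C]" "n * K"] x len
    by (simp add: B_P0_def dim_P_def)
  also have "mat_of_cols (n * K) [last ?C] *\<^sub>v 0\<^sub>v 1 = 0\<^sub>v (n * K)"
    by (intro eq_vecI) (auto simp: scalar_prod_def)
  also have "B_P0 n k w *\<^sub>v x + 0\<^sub>v (n * K) = B_P0 n k w *\<^sub>v x"
    using mult_mat_vec_carrier[OF B_P0_carrier x] by simp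
  finally show ?thesis ..
qed

lemma append_zero_carrier: "x \<in> carrier_vec (dim_P n k) \<Longrightarrow> x @\<^sub>v 0\<^sub>v 1 \<in> carrier_vec K"
  using K_pos append_carrier_vec[of x "dim_P n k" "0\<^sub>v 1" 1] by (simp add: dim_P_def)

lemma B_P0_mult_mem:
  assumes "x \<in> carrier_vec (dim_P n k)"
  shows "B_P0 n k w *\<^sub>v x \<in> PP"
proof -
  note y = append_zero_carrier[OF assms]
  show ?thesis
    unfolding B_P0_mult[OF assms] pure_potential_space_iff
  proof (intro conjI exI[of _ "\<lambda>s. (x @\<^sub>v 0\<^sub>v 1) $ ix s"] ballI)
    show "B_P n k w *\<^sub>v (x @\<^sub>v 0\<^sub>v 1) \<in> carrier_vec (n * K)"
      by (rule mult_mat_vec_carrier[OF B_P_carrier y])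
  qed (rule entry_B_P[OF _ _ y])
qed

text \<open>Only constants survive in the kernel of \<open>B_P\<close>, and the zero appended at
  index \<open>K - 1\<close> forces the constant to be 0.\<close>

lemma B_P0_inj:
  assumes x: "x \<in> carrier_vec (dim_P n k)" and zero: "B_P0 n k w *\<^sub>v x = 0\<^sub>v (n * K)"
  shows "x = 0\<^sub>v (dim_P n k)"
proof -
  let ?y = "x @\<^sub>v 0\<^sub>v 1"
  note y = append_zero_carrier[OF x]
  have mean: "?y $ ix s = mean i (\<lambda>s. ?y $ ix s) s" if "i \<in> players n" "s \<in> S" for i s
    using entry_B_P[OF that y] zero entry_zero[OF that] wt_pos[OF that]
    by (simp add: B_P0_mult[OF x])
  have inv: "?y $ ix (s(i := z)) = ?y $ ix s" if i: "i \<in> players n" and s: "s \<in> S" and z: "z \<in> {1..k i}" for i s z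
    using mean[OF i players_upd[OF i s z]] mean[OF i s] by simp
  have "K - 1 < K" using K_pos by simp
  then obtain t where t: "t \<in> S" "ix t = K - 1" by (rule obtain_profile_index)
  show ?thesis
  proof (rule eq_vecI)
    fix a assume "a < dim_vec (0\<^sub>v (dim_P n k) :: real vec)"
    then have a: "a < dim_P n k" by simp
    then have "a < K" by (simp add: dim_P_def)
    then obtain s where s: "s \<in> S" "ix s = a" by (rule obtain_profile_index)
    have "?y $ ix s = ?y $ ix t" by (rule invariant_imp_constant[OF inv s(1) t(1)])
    then show "x $ a = 0\<^sub>v (dim_P n k) $ a" using a x K_pos by (simp add: s t dim_P_def)
  qed (use x in simp)
qed

lemma B_N_mult_mem: "x \<in> carrier_vec (dim_N n k) \<Longrightarrow> B_N n k *\<^sub>v x \<in> NN"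
  unfolding nonstrategic_space_def vec_space.col_space_eq[OF B_N_carrier]
  using B_N_carrier by auto

text \<open>Every coordinate in the block of player \<open>i\<close> occurs as an entry of the
  product, at any extension of the corresponding coset profile; the extension by strategy 1 is
  taken.\<close>

lemma B_N_inj:
  assumes x: "x \<in> carrier_vec (dim_N n k)" and zero: "B_N n k *\<^sub>v x = 0\<^sub>v (n * K)"
  shows "x = 0\<^sub>v (dim_N n k)"
proof -
  obtain y where y: "\<And>i. i \<in> players n \<Longrightarrow> y i \<in> carrier_vec (prod k (others n i))"
    "x = stack_vecs (map y [1..<Suc n])" using split_others[OF x] by blast
  have "y i = 0\<^sub>v (prod k (others n i))" if i: "i \<in> players n" for i
  proof (rule eq_vecI)
    fix a assume "a < dim_vec (0\<^sub>v (prod k (others n i)) :: real vec)"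
    then have a: "a < prod k (others n i)" by simp
    then obtain t where t: "t \<in> profiles k (others n i)" "others_index n k i t = a" by (rule obtain_others_index)
    have s: "t(i := 1) \<in> S" using others_upd[OF i t(1)] k_pos[OF i] by simp
    have "others_index n k i (t(i := 1)) = a"
      by (metis t others_index_restrict restrict_upd_others_id)
    then show "y i $ a = 0\<^sub>v (prod k (others n i)) $ a"
      using entry_B_N[OF y(1) i s] entry_zero[OF i s] zero a by (simp add: y(2) del: upt_Suc)
  qed (use y(1)[OF i] in simp)
  then have "map y [1..<Suc n] = map (\<lambda>i. 0\<^sub>v (prod k (others n i))) [1..<Suc n]"
    by (rule map_players_cong)
  then show ?thesis unfolding y(2) dim_N_eq by (simp only: stack_zero_vecs)
qed

end

locale weighted_profiles_enum = weighted_profiles +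
  fixes js :: "nat \<Rightarrow> (nat \<Rightarrow> nat) list"
  assumes js: "J_enumeration n k js"
begin

abbreviation "M \<equiv> n * K"

text \<open>The block number accompanies the index profile because one profile may index columns in
  several blocks.\<close>

definition Jlist :: "(nat \<times> (nat \<Rightarrow> nat)) list" where
  "Jlist = concat (map (\<lambda>r. map (Pair r) (js r)) [1..<n])"

abbreviation "Jcol \<equiv> \<lambda>(r, s). J_vec n k w r s"

lemma js_enumerates: "r \<in> {1..<n} \<Longrightarrow> distinct (js r) \<and> set (js r) = J_index n k r"
  using js by (auto simp: J_enumeration_def)

lemma B_H_eq: "B_H n k w js = mat_of_cols M (map Jcol Jlist)"
  by (simp add: B_H_def Jlist_def map_concat o_def)

lemma set_Jlist: "(r, s) \<in> set Jlist \<longleftrightarrow> r \<in> {1..<n} \<and> s \<in> J_index n k r"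
  using js_enumerates by (auto simp: Jlist_def)

lemma distinct_Jlist: "distinct Jlist"
  unfolding Jlist_def
proof (rule distinct_concat)
  \<comment> \<open>Two empty inner lists would coincide as lists, so nonemptiness is required; the
    profile in which everyone plays 2 belongs to every index set.\<close>
  have ne: "js r \<noteq> []" if "r \<in> {1..<n}" for r
  proof -
    let ?s = "\<lambda>p. if p \<in> players n then 2 else undefined :: nat"
    have "?s \<in> J_index n k r"
      using that two_strategies by (auto simp: J_index_def profiles_def in_players PiE_iff extensional_def)
    then show ?thesis using js_enumerates[OF that] by auto
  qed
  show "distinct (map (\<lambda>r. map (Pair r) (js r)) [1..<n])"
    unfolding distinct_map
  proof (intro conjI inj_onI)
    fix r r' assume r: "r \<in> set [1..<n]" "r' \<in> set [1..<n]" "map (Pair r) (js r) = map (Pair r') (js r')"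
    then show "r = r'" using ne[of r] ne[of r'] by (cases "js r"; cases "js r'") auto
  qed simp
qed (use js_enumerates in \<open>auto simp: distinct_map inj_on_def\<close>)

lemma length_Jlist: "length Jlist = dim_H n k"
proof -
  have "length Jlist = (\<Sum>r\<leftarrow>[1..<n]. length (js r))"
    by (simp add: Jlist_def length_concat o_def)
  also have "\<dots> = (\<Sum>r\<in>{1..<n}. length (js r))"
    by (simp add: sum_list_distinct_conv_sum_set)
  also have "\<dots> = (\<Sum>r\<in>{1..<n}. card (J_index n k r))"
    using js_enumerates by (intro sum.cong) (auto simp: distinct_card[symmetric])
  finally show ?thesis by (simp only: sum_card_J_index)
qed

lemma B_H_carrier: "B_H n k w js \<in> carrier_mat M (dim_H n k)"
  using mat_of_cols_carrier(1)[of M "map Jcol Jlist"] by (simp add: B_H_eq length_Jlist)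

text \<open>Orthogonality passes through the transpose: the transpose of \<open>B_H\<close> kills
  every potential game, so the pairing of such a game with any column combination vanishes.\<close>

lemma B_H_mult_mem:
  assumes x: "x \<in> carrier_vec (dim_H n k)"
  shows "B_H n k w js *\<^sub>v x \<in> HH"
proof -
  let ?B = "B_H n k w js"
  have "(?B *\<^sub>v x) \<bullet> u = 0" if u: "u \<in> GP" for u
  proof -
    have uc: "u \<in> carrier_vec M" using u potential_space_iff by blast
    have "?B\<^sup>T *\<^sub>v u = 0\<^sub>v (dim_H n k)"
    proof (rule eq_vecI)
      fix j assume "j < dim_vec (0\<^sub>v (dim_H n k) :: real vec)"
      then have j: "j < length Jlist" by (simp add: length_Jlist)
      obtain r s where rs: "Jlist ! j = (r, s)" by (cases "Jlist ! j")
      then have mem: "r \<in> {1..<n}" "s \<in> J_index n k r" using nth_mem[OF j] by (simp_all add: set_Jlist)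
      then have s: "s \<in> S" by (simp add: J_index_def)
      have h: "J_vec n k w r s \<in> HH" by (rule J_vec_harmonic[OF mem(1) s])
      have "col ?B j = J_vec n k w r s"
        using col_mat_of_cols[of j "map Jcol Jlist" M] j rs J_vec_entry(1)[OF mem(1) s]
        by (simp add: B_H_eq)
      then show "(?B\<^sup>T *\<^sub>v u) $ j = 0\<^sub>v (dim_H n k) $ j"
        using h u j B_H_carrier
        by (simp add: pure_harmonic_space_def vec_module.orthogonal_complement_def length_Jlist)
    qed (use B_H_carrier in simp)
    then have "u \<bullet> (?B *\<^sub>v x) = 0"
      using transpose_vec_mult_scalar[OF B_H_carrier x uc] x by simp
    then show ?thesis
      using comm_scalar_prod[OF uc mult_mat_vec_carrier[OF B_H_carrier x]] by simp
  qed
  then show ?thesis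
    using mult_mat_vec_carrier[OF B_H_carrier x]
    by (simp add: pure_harmonic_space_def vec_module.orthogonal_complement_def)
qed

text \<open>Among the nonzero coefficients, one with maximal block number \<open>r\<close> is
  isolated by the row in block \<open>r + 1\<close> at its own index profile. Maximality removes the
  later blocks and triangularity the other columns, whatever the enumeration within a block.\<close>

lemma B_H_inj:
  assumes x: "x \<in> carrier_vec (dim_H n k)" and zero: "B_H n k w js *\<^sub>v x = 0\<^sub>v M"
  shows "x = 0\<^sub>v (dim_H n k)"
proof (rule ccontr)
  assume "x \<noteq> 0\<^sub>v (dim_H n k)"
  define I where "I = {j. j < length Jlist \<and> x $ j \<noteq> 0}"
  have "I \<noteq> {}"
  proof
    assume "I = {}"
    then have "x = 0\<^sub>v (dim_H n k)" using x by (intro eq_vecI) (auto simp: I_def length_Jlist)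
    then show False using \<open>x \<noteq> _\<close> by simp
  qed
  moreover have "finite I" by (simp add: I_def)
  ultimately have "Max ((\<lambda>j. fst (Jlist ! j)) ` I) \<in> (\<lambda>j. fst (Jlist ! j)) ` I"
    by (intro Max_in) auto
  then obtain j where j: "j \<in> I" and jmax: "Max ((\<lambda>j. fst (Jlist ! j)) ` I) = fst (Jlist ! j)"
    by auto
  have max: "fst (Jlist ! j') \<le> fst (Jlist ! j)" if "j' \<in> I" for j'
    using Max_ge[of "(\<lambda>j. fst (Jlist ! j)) ` I" "fst (Jlist ! j')"] that \<open>finite I\<close> by (simp add: jmax)
  obtain r s where rs: "Jlist ! j = (r, s)" by (cases "Jlist ! j")
  have jl: "j < length Jlist" using j by (simp add: I_def)
  have r: "r \<in> {1..<n}" and s: "s \<in> J_index n k r" using nth_mem[OF jl] by (simp_all add: set_Jlist rs)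
  have i: "Suc r \<in> players n" and sS: "s \<in> S" using r s by (simp_all add: in_players J_index_def)
  \<comment> \<open>Written with \<open>Suc r - 1\<close> to match the position read by
    \<open>entry\<close> for player \<open>Suc r\<close>.\<close>
  let ?a = "(Suc r - 1) * K + ix s"
  have "0 = (B_H n k w js *\<^sub>v x) $ ?a"
    using entry_zero[OF i sS] by (simp add: zero entry_def)
  also have "\<dots> = (\<Sum>j'<length Jlist. Jcol (Jlist ! j') $ ?a * x $ j')"
    unfolding B_H_eq
    using mult_mat_of_cols_index[of x "map Jcol Jlist" ?a M] x entry_index_less[OF i sS]
    by (simp add: length_Jlist)
  also have "\<dots> = (\<Sum>j'<length Jlist. if j' = j then - x $ j / wt (Suc r) s else 0)"
  proof (rule sum.cong[OF refl])
    fix j' assume "j' \<in> {..<length Jlist}"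
    then have j': "j' < length Jlist" by simp
    obtain r' s' where rs': "Jlist ! j' = (r', s')" by (cases "Jlist ! j'")
    have m': "r' \<in> {1..<n}" "s' \<in> J_index n k r'" using nth_mem[OF j'] by (simp_all add: set_Jlist rs')
    have eq: "r' = r \<and> s' = s \<longleftrightarrow> j' = j"
      using nth_eq_iff_index_eq[OF distinct_Jlist j' jl] by (simp add: rs rs')
    show "Jcol (Jlist ! j') $ ?a * x $ j' = (if j' = j then - x $ j / wt (Suc r) s else 0)"
    proof (cases "r' \<le> r")
      case True
      have "Jcol (Jlist ! j') $ ?a = ent (J_vec n k w r' s') (Suc r) s"
        by (simp add: rs' entry_def)
      then show ?thesis
        using J_vec_triangular[OF r s m'(1) True m'(2)] eq by simp
    next
      case False
      then have "x $ j' = 0" using max[of j'] j' by (auto simp: I_def rs rs')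
      moreover have "j' \<noteq> j" using False eq by auto
      ultimately show ?thesis by simp
    qed
  qed
  also have "\<dots> = - x $ j / wt (Suc r) s" using jl by simp
  finally show False using j wt_pos[OF i sS] by (simp add: I_def)
qed

abbreviation "B \<equiv> B_cw n k w js"

lemma B_cw_carrier: "B \<in> carrier_mat M M"
  using B_P0_carrier B_N_carrier B_H_carrier dims_add
  by (intro carrier_matI) (auto simp: B_cw_def)

lemma B_cw_mult:
  assumes "x \<in> carrier_vec (dim_P n k)" "y \<in> carrier_vec (dim_N n k)" "z \<in> carrier_vec (dim_H n k)"
  shows "B *\<^sub>v (x @\<^sub>v y @\<^sub>v z) = B_P0 n k w *\<^sub>v x + (B_N n k *\<^sub>v y + B_H n k w js *\<^sub>v z)"
proof -
  have len: "length (cols (B_P0 n k w)) = dim_P n k" "length (cols (B_N n k)) = dim_N n k"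
    "length (cols (B_H n k w js)) = dim_H n k"
    using B_P0_carrier B_N_carrier B_H_carrier by auto
  have "B *\<^sub>v (x @\<^sub>v y @\<^sub>v z) = mat_of_cols M (cols (B_P0 n k w)) *\<^sub>v x
      + mat_of_cols M (cols (B_N n k) @ cols (B_H n k w js)) *\<^sub>v (y @\<^sub>v z)"
    unfolding B_cw_def
    by (rule mat_of_cols_append_mult) (simp_all only: length_append len assms append_carrier_vec)
  also have "mat_of_cols M (cols (B_N n k) @ cols (B_H n k w js)) *\<^sub>v (y @\<^sub>v z)
      = mat_of_cols M (cols (B_N n k)) *\<^sub>v y + mat_of_cols M (cols (B_H n k w js)) *\<^sub>v z"
    by (rule mat_of_cols_append_mult) (simp_all only: len assms)
  finally show ?thesis
    by (simp only: mat_of_cols_cols_carrier[OF B_P0_carrier] mat_of_cols_cols_carrier[OF B_N_carrier]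
        mat_of_cols_cols_carrier[OF B_H_carrier])
qed

lemma spaces_carrier: "PP \<subseteq> carrier_vec M" "NN \<subseteq> carrier_vec M" "HH \<subseteq> carrier_vec M" "GP \<subseteq> carrier_vec M"
  using pure_potential_space_iff nonstrategic_space_iff potential_space_iff
  by (auto simp: pure_harmonic_space_def vec_module.orthogonal_complement_def)

lemma spaces_zero: "0\<^sub>v M \<in> PP" "0\<^sub>v M \<in> NN" "0\<^sub>v M \<in> HH"
proof -
  show "0\<^sub>v M \<in> PP"
    unfolding pure_potential_space_iff
    by (intro conjI exI[of _ "\<lambda>_. 0"]) (auto simp: entry_zero mean_def)
  show "0\<^sub>v M \<in> NN"
    unfolding nonstrategic_space_iff using entry_zero players_upd by auto
  show "0\<^sub>v M \<in> HH"
    using spaces_carrier by (auto simp: pure_harmonic_space_def vec_module.orthogonal_complement_def)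
qed

lemma PP_NN_subset_GP: "PP \<subseteq> GP" "NN \<subseteq> GP"
proof -
  have "p + 0\<^sub>v M \<in> GP" if "p \<in> PP" for p
    unfolding potential_space_eq_sum sum_space_def using that spaces_zero by blast
  then show "PP \<subseteq> GP" using spaces_carrier by (metis (no_types, lifting) right_zero_vec subsetD subsetI)
  have "0\<^sub>v M + q \<in> GP" if "q \<in> NN" for q
    unfolding potential_space_eq_sum sum_space_def using that spaces_zero by blast
  then show "NN \<subseteq> GP" using spaces_carrier by (metis (no_types, lifting) left_zero_vec subsetD subsetI)
qed

lemma harmonic_orth: "h \<in> HH \<Longrightarrow> u \<in> GP \<Longrightarrow> h \<bullet> u = 0 \<and> u \<bullet> h = 0"
  using comm_scalar_prod[of h M u] spaces_carrier
  by (auto simp: pure_harmonic_space_def vec_module.orthogonal_complement_def)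

lemma orth:
  assumes "p \<in> PP" "q \<in> NN" "h \<in> HH"
  shows "p \<bullet> q = 0" "q \<bullet> p = 0" "p \<bullet> h = 0" "h \<bullet> p = 0" "q \<bullet> h = 0" "h \<bullet> q = 0"
proof -
  have c: "p \<in> carrier_vec M" "q \<in> carrier_vec M" using assms spaces_carrier by (blast dest: subsetD)+
  show "q \<bullet> p = 0" by (rule pure_potential_orth_nonstrategic[OF assms(1,2)])
  then show "p \<bullet> q = 0" by (simp add: comm_scalar_prod[OF c])
  have "p \<in> GP" "q \<in> GP" using assms PP_NN_subset_GP by (blast dest: subsetD)+
  then show "p \<bullet> h = 0" "h \<bullet> p = 0" "q \<bullet> h = 0" "h \<bullet> q = 0"
    using harmonic_orth[OF assms(3)] by simp_all
qed

text \<open>Pairing the zero sum with each summand leaves the squared norm of that summand.\<close>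

lemma orth_sum_eq_0:
  assumes p: "p \<in> PP" and q: "q \<in> NN" and h: "h \<in> HH" and zero: "p + (q + h) = 0\<^sub>v M"
  shows "p = 0\<^sub>v M" "q = 0\<^sub>v M" "h = 0\<^sub>v M"
proof -
  have c: "p \<in> carrier_vec M" "q \<in> carrier_vec M" "h \<in> carrier_vec M" "q + h \<in> carrier_vec M"
    using subsetD[OF spaces_carrier(1) p] subsetD[OF spaces_carrier(2) q] subsetD[OF spaces_carrier(3) h]
    by auto
  note o = orth[OF p q h]
  have expand: "u \<bullet> (p + (q + h)) = u \<bullet> p + (u \<bullet> q + u \<bullet> h)" if "u \<in> carrier_vec M" for u
    using that c by (simp add: scalar_prod_add_distrib[of _ M])
  have "p \<bullet> p = 0" using expand[OF c(1)] o c by (simp add: zero)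
  then show "p = 0\<^sub>v M" by (rule scalar_prod_self_eq_0[OF c(1)])
  have "q \<bullet> q = 0" using expand[OF c(2)] o c by (simp add: zero)
  then show "q = 0\<^sub>v M" by (rule scalar_prod_self_eq_0[OF c(2)])
  have "h \<bullet> h = 0" using expand[OF c(3)] o c by (simp add: zero)
  then show "h = 0\<^sub>v M" by (rule scalar_prod_self_eq_0[OF c(3)])
qed

lemma split_coordinates:
  assumes "x \<in> carrier_vec M"
  obtains xp xn xh where "xp \<in> carrier_vec (dim_P n k)" "xn \<in> carrier_vec (dim_N n k)"
    "xh \<in> carrier_vec (dim_H n k)" "x = xp @\<^sub>v xn @\<^sub>v xh"
proof
  let ?r = "vec_last x (dim_N n k + dim_H n k)"
  have x: "x \<in> carrier_vec (dim_P n k + (dim_N n k + dim_H n k))" using assms dims_add by simp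
  show "x = vec_first x (dim_P n k) @\<^sub>v vec_first ?r (dim_N n k) @\<^sub>v vec_last ?r (dim_H n k)"
    using vec_first_last_append[OF x] vec_first_last_append[of ?r "dim_N n k" "dim_H n k"] by simp
qed auto

lemma B_cw_inj:
  assumes x: "x \<in> carrier_vec M" and zero: "B *\<^sub>v x = 0\<^sub>v M"
  shows "x = 0\<^sub>v M"
proof -
  obtain xp xn xh where c: "xp \<in> carrier_vec (dim_P n k)" "xn \<in> carrier_vec (dim_N n k)"
    "xh \<in> carrier_vec (dim_H n k)" and xeq: "x = xp @\<^sub>v xn @\<^sub>v xh"
    using split_coordinates[OF x] by blast
  have "B_P0 n k w *\<^sub>v xp + (B_N n k *\<^sub>v xn + B_H n k w js *\<^sub>v xh) = 0\<^sub>v M"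
    using zero B_cw_mult[OF c] by (simp add: xeq)
  from orth_sum_eq_0[OF B_P0_mult_mem[OF c(1)] B_N_mult_mem[OF c(2)] B_H_mult_mem[OF c(3)] this]
  have "xp = 0\<^sub>v (dim_P n k)" "xn = 0\<^sub>v (dim_N n k)" "xh = 0\<^sub>v (dim_H n k)"
    using B_P0_inj[OF c(1)] B_N_inj[OF c(2)] B_H_inj[OF c(3)] by auto
  then show ?thesis
    unfolding xeq dims_add[symmetric] by (intro eq_vecI) auto
qed

lemmas B_cw_inv = invertible_mat_of_inj[OF B_cw_carrier B_cw_inj]

text \<open>Each projection claim reduces to the residual: it consists of those components of
  \<open>V\<close> that are orthogonal to the target space.\<close>

lemma decomposition:
  assumes c: "x \<in> carrier_vec (dim_P n k)" "y \<in> carrier_vec (dim_N n k)" "z \<in> carrier_vec (dim_H n k)"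
    and V: "V \<in> carrier_vec M" and coord: "x @\<^sub>v y @\<^sub>v z = mat_inv B *\<^sub>v V"
  shows "orth_proj M PP V = B *\<^sub>v (x @\<^sub>v 0\<^sub>v (dim_N n k) @\<^sub>v 0\<^sub>v (dim_H n k))"
    and "orth_proj M HH V = B *\<^sub>v (0\<^sub>v (dim_P n k) @\<^sub>v 0\<^sub>v (dim_N n k) @\<^sub>v z)"
    and "orth_proj M NN V = B *\<^sub>v (0\<^sub>v (dim_P n k) @\<^sub>v y @\<^sub>v 0\<^sub>v (dim_H n k))"
    and "orth_proj M GP V = orth_proj M PP V + orth_proj M NN V"
    and "orth_proj M (sum_space NN HH) V = orth_proj M HH V + orth_proj M NN V"
proof -
  define p q h where "p = B_P0 n k w *\<^sub>v x" and "q = B_N n k *\<^sub>v y" and "h = B_H n k w js *\<^sub>v z"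
  have mem: "p \<in> PP" "q \<in> NN" "h \<in> HH"
    unfolding p_def q_def h_def by (rule B_P0_mult_mem[OF c(1)] B_N_mult_mem[OF c(2)] B_H_mult_mem[OF c(3)])+
  then have carr: "p \<in> carrier_vec M" "q \<in> carrier_vec M" "h \<in> carrier_vec M"
    using spaces_carrier by auto
  \<comment> \<open>Applying the matrix to the coordinates cancels the inverse and yields the
    splitting of \<open>V\<close> into the three components.\<close>
  have "B *\<^sub>v (x @\<^sub>v y @\<^sub>v z) = (B * mat_inv B) *\<^sub>v V"
    unfolding coord by (rule assoc_mult_mat_vec[OF B_cw_carrier B_cw_inv(2) V, symmetric])
  then have Veq: "V = p + (q + h)"
    using V B_cw_inv(3) by (simp add: B_cw_mult[OF c] p_def q_def h_def)
  have zero: "B_P0 n k w *\<^sub>v 0\<^sub>v (dim_P n k) = 0\<^sub>v M" "B_N n k *\<^sub>v 0\<^sub>v (dim_N n k) = 0\<^sub>v M"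
    "B_H n k w js *\<^sub>v 0\<^sub>v (dim_H n k) = 0\<^sub>v M"
    using B_P0_carrier B_N_carrier B_H_carrier by (auto intro!: eq_vecI)
  have diffs: "V - p = q + h" "V - h = p + q" "V - q = p + h" "V - (p + q) = h" "V - (h + q) = p"
    unfolding Veq using carr by (auto intro!: eq_vecI)
  have add: "(a + b) \<bullet> u = a \<bullet> u + b \<bullet> u"
    if "a \<in> carrier_vec M" "b \<in> carrier_vec M" "u \<in> carrier_vec M" for a b u :: "real vec"
    using that by (rule add_scalar_prod_distrib)
  have PP: "orth_proj M PP V = p"
    by (rule orth_projI[OF spaces_carrier(1) mem(1) V])
      (use spaces_carrier carr mem orth in \<open>auto simp: diffs add subset_iff\<close>)
  have HH: "orth_proj M HH V = h"
    by (rule orth_projI[OF spaces_carrier(3) mem(3) V])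
      (use spaces_carrier carr mem orth in \<open>auto simp: diffs add subset_iff\<close>)
  have NN: "orth_proj M NN V = q"
    by (rule orth_projI[OF spaces_carrier(2) mem(2) V])
      (use spaces_carrier carr mem orth in \<open>auto simp: diffs add subset_iff\<close>)
  show "orth_proj M PP V = B *\<^sub>v (x @\<^sub>v 0\<^sub>v (dim_N n k) @\<^sub>v 0\<^sub>v (dim_H n k))"
    using B_cw_mult[OF c(1) zero_carrier_vec zero_carrier_vec] carr by (simp add: zero PP p_def)
  show "orth_proj M HH V = B *\<^sub>v (0\<^sub>v (dim_P n k) @\<^sub>v 0\<^sub>v (dim_N n k) @\<^sub>v z)"
    using B_cw_mult[OF zero_carrier_vec zero_carrier_vec c(3)] carr by (simp add: zero HH h_def)
  show "orth_proj M NN V = B *\<^sub>v (0\<^sub>v (dim_P n k) @\<^sub>v y @\<^sub>v 0\<^sub>v (dim_H n k))"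
    using B_cw_mult[OF zero_carrier_vec c(2) zero_carrier_vec] carr by (simp add: zero NN q_def)
  have "p + q \<in> GP" unfolding potential_space_eq_sum sum_space_def using mem by blast
  then have "orth_proj M GP V = p + q"
    by (rule orth_projI[OF spaces_carrier(4) _ V]) (use harmonic_orth[OF mem(3)] in \<open>simp add: diffs\<close>)
  then show "orth_proj M GP V = orth_proj M PP V + orth_proj M NN V" by (simp add: PP NN)
  have "orth_proj M (sum_space NN HH) V = h + q"
  proof (rule orth_projI[OF _ _ V])
    show "sum_space NN HH \<subseteq> carrier_vec M"
      using subsetD[OF spaces_carrier(2)] subsetD[OF spaces_carrier(3)] by (auto simp: sum_space_def)
    \<comment> \<open>\<open>sum_space\<close> lists the non-strategic summand first, the claimed
      projection lists it last.\<close>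
    have "h + q = q + h" using carr by (intro comm_add_vec) auto
    then show "h + q \<in> sum_space NN HH" unfolding sum_space_def using mem by blast
    fix u assume "u \<in> sum_space NN HH"
    then obtain u1 u2 where u: "u = u1 + u2" "u1 \<in> NN" "u2 \<in> HH" by (auto simp: sum_space_def)
    then have "p \<bullet> u = p \<bullet> u1 + p \<bullet> u2"
      using spaces_carrier carr by (auto intro!: scalar_prod_add_distrib)
    then show "(V - (h + q)) \<bullet> u = 0" using orth[OF mem(1) u(2,3)] by (simp add: diffs)
  qed
  then show "orth_proj M (sum_space NN HH) V = orth_proj M HH V + orth_proj M NN V" by (simp add: HH NN)
qed

text \<open>A common element is orthogonal to itself. The lemma \<open>orth\<close> expects a vector
  from each of the three spaces; the zero vector fills the remaining slot.\<close>

lemma spaces_inter: "PP \<inter> NN = {0\<^sub>v M}" "NN \<inter> HH = {0\<^sub>v M}"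
proof -
  have "v = 0\<^sub>v M" if "v \<in> PP" "v \<in> NN" for v
    by (rule scalar_prod_self_eq_0[OF subsetD[OF spaces_carrier(1) that(1)] orth(1)[OF that spaces_zero(3)]])
  then show "PP \<inter> NN = {0\<^sub>v M}" using spaces_zero by blast
  have "v = 0\<^sub>v M" if "v \<in> NN" "v \<in> HH" for v
    by (rule scalar_prod_self_eq_0[OF subsetD[OF spaces_carrier(2) that(1)] orth(5)[OF spaces_zero(1) that]])
  then show "NN \<inter> HH = {0\<^sub>v M}" using spaces_zero by blast
qed

end

text \<open>The dimension and invertibility conjuncts make the splitting of the coordinate vector
  into three parts meaningful. Directness of the two sums is expressed by trivial intersections, and
  \<open>js\<close> leaves the order of the columns within each harmonic block open.\<close>

theorem proposition22:
  fixes n :: nat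
    and k :: "nat \<Rightarrow> nat"
    and w c :: "nat \<Rightarrow> (nat \<Rightarrow> nat) \<Rightarrow> real"
    and js :: "nat \<Rightarrow> (nat \<Rightarrow> nat) list"
  assumes "n \<ge> 2"
    and "\<forall>i\<in>players n. k i \<ge> 2"
    and "\<forall>i\<in>players n. \<forall>s\<in>profiles k (others n i). w i s > 0"
    and "J_enumeration n k js"
  defines "m \<equiv> n * profile_count n k"
    and "d1 \<equiv> dim_P n k"
    and "d2 \<equiv> dim_N n k"
    and "d3 \<equiv> dim_H n k"
    and "B \<equiv> B_cw n k w js"
    and "V \<equiv> game_vec n k c"
    and "PP \<equiv> pure_potential_space n k w"
    and "NN \<equiv> nonstrategic_space n k"
    and "HH \<equiv> pure_harmonic_space n k w"
    and "GP \<equiv> potential_space n k w"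
  shows "B_P0 n k w \<in> carrier_mat m d1 \<and> B_N n k \<in> carrier_mat m d2 \<and>
    B_H n k w js \<in> carrier_mat m d3 \<and> B \<in> carrier_mat m m \<and> invertible_mat B \<and>
    (\<forall>X_P\<in>carrier_vec d1. \<forall>X_N\<in>carrier_vec d2. \<forall>X_H\<in>carrier_vec d3.
      X_P @\<^sub>v X_N @\<^sub>v X_H = mat_inv B *\<^sub>v V \<longrightarrow>
        orth_proj m PP V = B *\<^sub>v (X_P @\<^sub>v 0\<^sub>v d2 @\<^sub>v 0\<^sub>v d3) \<and>
        orth_proj m HH V = B *\<^sub>v (0\<^sub>v d1 @\<^sub>v 0\<^sub>v d2 @\<^sub>v X_H) \<and>
        orth_proj m NN V = B *\<^sub>v (0\<^sub>v d1 @\<^sub>v X_N @\<^sub>v 0\<^sub>v d3) \<and>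
        (GP = sum_space PP NN \<and> PP \<inter> NN = {0\<^sub>v m} \<and>
          orth_proj m GP V = orth_proj m PP V + orth_proj m NN V) \<and>
        (NN \<inter> HH = {0\<^sub>v m} \<and>
          orth_proj m (sum_space NN HH) V = orth_proj m HH V + orth_proj m NN V))"
proof -
  interpret weighted_profiles_enum n k w js
    by unfold_locales (use assms(1-4) in auto)
  show ?thesis
    unfolding m_def d1_def d2_def d3_def B_def V_def PP_def NN_def HH_def GP_def
    by (intro conjI ballI impI)
      (assumption | rule B_P0_carrier B_N_carrier B_H_carrier B_cw_carrier B_cw_inv(1)
        decomposition[OF _ _ _ game_vec_carrier] potential_space_eq_sum spaces_inter)+
qed

end
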